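(* If $n>5$, then the alternating group $A_n$ is neither a purely strongly real Beauville group nor a purely non-strongly real Beauville group.
   Context: Conjugation convention: $g^h=hgh^{-1}$. For a finite group $G$ with identity $e$ and $x,y\in G$, let \[ \Sigma(x,y):=\bigcup_{i=1}^{|G|}\bigcup_{g\in G}\{(x^i)^g,(y^i)^g,((xy)^i)^g\}. \] A Beauville structure for a finite group $G$ is a set of pairs $\{(x_1,y_1),(x_2,y_2)\}\subset G\times G$ such that $\langle x_1,y_1\rangle=\langle x_2,y_2\rangle=G$ and $\Sigma(x_1,y_1)\cap\Sigma(x_2,y_2)=\{e\}$. A finite group $G$ is a Beauville group if it has a Beauville structure. A Beauville structure $\{(x_1,y_1),(x_2,y_2)\}$ of $G$ is strongly real if there exist an automorphism $\phi\in\mathrm{Aut}(G)$ and elements $g_1,g_2\in G$ such that $g_i\phi(x_i)g_i^{-1}=x_i^{-1}$ and $g_i\phi(y_i)g_i^{-1}=y_i^{-1}$ for $i=1,2$. A finite group $G$ is a purely strongly real Beauville group if $G$ is a Beauville group and every Beauville structure of $G$ is strongly real. It is a purely non-strongly real Beauville group if $G$ is a Beauville group and none of its Beauville structures is strongly real. *)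

theory Defs
  imports
    "HOL-Algebra.Bij"
    "HOL-Algebra.Generated_Groups"
    "HOL-Algebra.Sym_Groups"
begin

definition beauville_Sigma :: "('a, 'b) monoid_scheme \<Rightarrow> 'a \<Rightarrow> 'a \<Rightarrow> 'a set"
  where "beauville_Sigma G x y =
    (\<Union>i\<in>{1..order G}. \<Union>g\<in>carrier G.
      {g \<otimes>\<^bsub>G\<^esub> (x [^]\<^bsub>G\<^esub> i) \<otimes>\<^bsub>G\<^esub> inv\<^bsub>G\<^esub> g,
       g \<otimes>\<^bsub>G\<^esub> (y [^]\<^bsub>G\<^esub> i) \<otimes>\<^bsub>G\<^esub> inv\<^bsub>G\<^esub> g,
       g \<otimes>\<^bsub>G\<^esub> ((x \<otimes>\<^bsub>G\<^esub> y) [^]\<^bsub>G\<^esub> i) \<otimes>\<^bsub>G\<^esub> inv\<^bsub>G\<^esub> g})"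

definition beauville_structure :: "('a, 'b) monoid_scheme \<Rightarrow> ('a \<times> 'a) set \<Rightarrow> bool"
  where "beauville_structure G B \<longleftrightarrow>
    (\<exists>x1\<in>carrier G. \<exists>y1\<in>carrier G. \<exists>x2\<in>carrier G. \<exists>y2\<in>carrier G.
      B = {(x1, y1), (x2, y2)} \<and>
      generate G {x1, y1} = carrier G \<and>
      generate G {x2, y2} = carrier G \<and>
      beauville_Sigma G x1 y1 \<inter> beauville_Sigma G x2 y2 = {\<one>\<^bsub>G\<^esub>})"

definition beauville_group :: "('a, 'b) monoid_scheme \<Rightarrow> bool"
  where "beauville_group G \<longleftrightarrow>
    group G \<and> finite (carrier G) \<and> (\<exists>B. beauville_structure G B)"

(* The condition is symmetric in the two pairs, so it does not depend on how the
   elements of B are numbered. *)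
definition strongly_real :: "('a, 'b) monoid_scheme \<Rightarrow> ('a \<times> 'a) set \<Rightarrow> bool"
  where "strongly_real G B \<longleftrightarrow>
    (\<exists>x1 y1 x2 y2. B = {(x1, y1), (x2, y2)} \<and>
      (\<exists>\<phi>\<in>auto G. \<exists>g1\<in>carrier G. \<exists>g2\<in>carrier G.
        g1 \<otimes>\<^bsub>G\<^esub> \<phi> x1 \<otimes>\<^bsub>G\<^esub> inv\<^bsub>G\<^esub> g1 = inv\<^bsub>G\<^esub> x1 \<and>
        g1 \<otimes>\<^bsub>G\<^esub> \<phi> y1 \<otimes>\<^bsub>G\<^esub> inv\<^bsub>G\<^esub> g1 = inv\<^bsub>G\<^esub> y1 \<and>
        g2 \<otimes>\<^bsub>G\<^esub> \<phi> x2 \<otimes>\<^bsub>G\<^esub> inv\<^bsub>G\<^esub> g2 = inv\<^bsub>G\<^esub> x2 \<and>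
        g2 \<otimes>\<^bsub>G\<^esub> \<phi> y2 \<otimes>\<^bsub>G\<^esub> inv\<^bsub>G\<^esub> g2 = inv\<^bsub>G\<^esub> y2))"

definition purely_strongly_real_beauville_group :: "('a, 'b) monoid_scheme \<Rightarrow> bool"
  where "purely_strongly_real_beauville_group G \<longleftrightarrow>
    beauville_group G \<and> (\<forall>B. beauville_structure G B \<longrightarrow> strongly_real G B)"

definition purely_non_strongly_real_beauville_group :: "('a, 'b) monoid_scheme \<Rightarrow> bool"
  where "purely_non_strongly_real_beauville_group G \<longleftrightarrow>
    beauville_group G \<and> (\<forall>B. beauville_structure G B \<longrightarrow> \<not> strongly_real G B)"

end

(*
  Both Beauville structures are separated by numbers of fixed points: these numbers are conjugation
  invariant, and for the pairs used here they can be read off from the orbits of x, y and x y, since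
  a power of p that fixes one point of an orbit of p fixes the whole orbit. Generation is obtained
  from one 3-cycle in the generated group: being together in a 3-cycle of the group is an
  equivalence relation invariant under the group, and it turns out to be total.

  Strong reality is decided by permutations inverting both members of a generating pair. Such a
  permutation is unique; if one exists for each pair and they have the same parity, the structure is
  strongly real. If it exists for one pair but not for the other one, the structure is not strongly
  real, since then the automorphism is conjugation by a permutation.

  Degree 6 is exceptional: no structure of the alternating group of degree 6 is made strongly real by
  a permutation, and an automorphism coming from the outer automorphism of the symmetric group is
  needed.
*)
theory Submission
  imports Defs "HOL-Algebra.Multiplicative_Group"
begin

section \<open>Fixed points of powers\<close>

text \<open>Each pair is chosen so that both members and their product have at most two nontrivial
  cycles; the fixed-point counts of all powers then form a short list, and the lists of the two
  pairs should share only n. Parity splits the construction: an n-cycle is even only for odd n, an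
  (n-1)-cycle only for even n, and for even n a cycle on n-2 points must be accompanied by a
  transposition. A permutation inverting a cycle acts on its points as a reflection of a polygon, so
  the other generator is arranged to be symmetric under one such reflection, or to violate all of
  them. Equal parity is what places the quotient of the two inverting permutations in the
  alternating group. In degree 6 the exotic automorphism exchanges 3-cycles with products of two
  disjoint 3-cycles, so the strongly real structure there is built from 5-cycles and elements of
  type 4+2, whose cycle types it preserves.\<close>

definition fixpts :: "nat \<Rightarrow> (nat \<Rightarrow> nat) \<Rightarrow> nat"
  where "fixpts n p = card {i \<in> {1..n}. p i = i}"

lemma fixpts_conj:
  assumes "g permutes {1..n}"
  shows "fixpts n (g \<circ> p \<circ> inv' g) = fixpts n p"
proof -
  have "{i \<in> {1..n}. (g \<circ> p \<circ> inv' g) i = i} = g ` {i \<in> {1..n}. p i = i}"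
  proof (intro Set.set_eqI iffI)
    fix i assume "i \<in> {i \<in> {1..n}. (g \<circ> p \<circ> inv' g) i = i}"
    then have i: "i \<in> {1..n}" "g (p (inv' g i)) = i" by auto
    have "p (inv' g i) = inv' g i"
      using i(2) permutes_inverses[OF assms] by metis
    moreover have "inv' g i \<in> {1..n}"
      using i(1) permutes_in_image[OF permutes_inv[OF assms]] by auto
    ultimately show "i \<in> g ` {i \<in> {1..n}. p i = i}"
      using permutes_inverses(1)[OF assms, of i] by (metis (mono_tags, lifting) image_eqI mem_Collect_eq)
  next
    fix i assume "i \<in> g ` {i \<in> {1..n}. p i = i}"
    then show "i \<in> {i \<in> {1..n}. (g \<circ> p \<circ> inv' g) i = i}"
      using permutes_in_image[OF assms] permutes_inverses[OF assms] by auto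
  qed
  moreover have "inj_on g {i \<in> {1..n}. p i = i}"
    using permutes_inj_on[OF assms] by blast
  ultimately show ?thesis
    unfolding fixpts_def by (simp add: card_image)
qed

lemma fixpts_full:
  assumes "p permutes {1..n}" "fixpts n p = n"
  shows "p = id"
proof -
  have "card {i \<in> {1..n}. p i = i} = card {1..n}"
    using assms(2) by (simp add: fixpts_def)
  then have "{i \<in> {1..n}. p i = i} = {1..n}"
    by (intro card_subset_eq) auto
  then show ?thesis
    using permutes_not_in[OF assms(1)] by (metis (mono_tags, lifting) eq_id_iff mem_Collect_eq)
qed

definition reaches :: "('a \<Rightarrow> 'a) \<Rightarrow> 'a \<Rightarrow> 'a \<Rightarrow> bool"
  where "reaches p a b \<longleftrightarrow> (\<exists>j. (p ^^ j) a = b)"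

lemma reaches_refl [simp]: "reaches p a a"
  unfolding reaches_def by (metis funpow_0)

lemma reaches_step: "reaches p a b \<Longrightarrow> p b = c \<Longrightarrow> reaches p a c"
  unfolding reaches_def by (metis comp_apply funpow.simps(2))

lemma reaches_first: "p a = b \<Longrightarrow> reaches p a b"
  using reaches_step[OF reaches_refl] .

lemma reaches_interval:
  assumes "\<And>i. u \<le> i \<Longrightarrow> i < v \<Longrightarrow> p i = Suc i" "reaches p a u" "u \<le> b" "b \<le> v"
  shows "reaches p a b"
  using assms(3,4)
proof (induction b rule: dec_induct)
  case base
  then show ?case using assms(2) by simp
next
  case (step i)
  then show ?case using assms(1)[of i] reaches_step[of p a i] by simp
qed

text \<open>The base point may lie outside \<open>S\<close>, and \<open>S\<close> may be part of an
  orbit: a common forward orbit already transfers fixedness of a power between points of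
  \<open>S\<close>. The empty set qualifies, which lets the two-orbit count below also cover a
  single cycle.\<close>

definition single_orbit :: "('a \<Rightarrow> 'a) \<Rightarrow> 'a set \<Rightarrow> bool"
  where "single_orbit p S \<longleftrightarrow> (\<exists>a. \<forall>b\<in>S. reaches p a b)"

lemma single_orbitI: "(\<And>b. b \<in> S \<Longrightarrow> reaches p a b) \<Longrightarrow> single_orbit p S"
  unfolding single_orbit_def by blast

lemma single_orbit_empty [simp]: "single_orbit p {}"
  by (simp add: single_orbit_def)

text \<open>Powers of \<open>p\<close> commute, so by injectivity \<open>p ^^ k\<close> fixes
  \<open>(p ^^ j) a\<close> exactly when it fixes the base point \<open>a\<close>.\<close>

lemma single_orbit_fixed:
  assumes "inj p" "single_orbit p S" "i \<in> S" "(p ^^ k) i = i" "b \<in> S"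
  shows "(p ^^ k) b = b"
proof -
  obtain a where a: "\<forall>b\<in>S. reaches p a b"
    using assms(2) unfolding single_orbit_def by blast
  then obtain j l where j: "(p ^^ j) a = i" and l: "(p ^^ l) a = b"
    using assms(3,5) unfolding reaches_def by blast
  have comm: "(p ^^ k) ((p ^^ m) a) = (p ^^ m) ((p ^^ k) a)" for m
    by (metis add.commute comp_apply funpow_add)
  have "(p ^^ k) ((p ^^ j) a) = (p ^^ j) a" using assms(4) j by simp
  then have "(p ^^ j) ((p ^^ k) a) = (p ^^ j) a" using comm[of j] by simp
  moreover have "inj (p ^^ j)" using assms(1) by (rule inj_fn)
  ultimately have "(p ^^ k) a = a" by (meson injD)
  then show ?thesis using l comm[of l] by simp
qed

text \<open>A power fixes all or none of each orbit, so its fixed points are \<open>C\<close>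
  together with a choice among \<open>A\<close> and \<open>B\<close>.\<close>

lemma fixpts_funpow:
  assumes "p permutes {1..n}" "single_orbit p A" "single_orbit p B" "\<And>i. i \<in> C \<Longrightarrow> p i = i"
    and "{1..n} = A \<union> B \<union> C" "A \<inter> B = {}" "A \<inter> C = {}" "B \<inter> C = {}"
  shows "fixpts n (p ^^ k) \<in> {card C, card C + card A, card C + card B, n}"
proof -
  have fin: "finite A" "finite B" "finite C"
    using assms(5) by (metis finite_Un finite_atLeastAtMost)+
  have inj: "inj p" using assms(1) by (rule permutes_inj)
  have C: "(p ^^ k) i = i" if "i \<in> C" for i
    using assms(4)[OF that] by (induction k) auto
  define F where "F S = {i \<in> S. (p ^^ k) i = i}" for S
  have F: "F S = {} \<or> F S = S" if "single_orbit p S" for S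
    using single_orbit_fixed[OF inj that] unfolding F_def by auto
  have "{i \<in> {1..n}. (p ^^ k) i = i} = F A \<union> F B \<union> C"
    unfolding assms(5) F_def using C by auto
  moreover have "card (F A \<union> F B \<union> C) = card (F A) + card (F B) + card C"
    using fin assms(6-8) unfolding F_def by (subst card_Un_disjoint; auto)+
  moreover have "n = card A + card B + card C"
  proof -
    have "card {1..n} = card A + card B + card C"
      unfolding assms(5) using fin assms(6-8) by (subst card_Un_disjoint; auto)+
    then show ?thesis by simp
  qed
  ultimately show ?thesis
    using F[OF assms(2)] F[OF assms(3)] unfolding fixpts_def by auto
qed

section \<open>Beauville structures on alternating groups\<close>

lemma alt_group_pow: "x [^]\<^bsub>alt_group n\<^esub> (k::nat) = x ^^ k"
proof -
  interpret group "alt_group n" by (rule alt_group_is_group)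
  show ?thesis
    by (induction k) (simp_all add: alt_group_one alt_group_mult nat_pow_Suc funpow_Suc_right del: funpow.simps(2))
qed

lemma finite_alt_group: "finite (carrier (alt_group n))"
proof -
  have "finite {p. p permutes {1..n}}" by (simp add: finite_permutations)
  then show ?thesis by (rule rev_finite_subset) (auto simp: alt_group_carrier)
qed

lemma alt_group_permutes: "p \<in> carrier (alt_group n) \<Longrightarrow> p permutes {1..n}"
  by (simp add: alt_group_carrier)

lemma mem_beauville_Sigma_alt:
  assumes "x \<in> carrier (alt_group n)" "y \<in> carrier (alt_group n)"
  shows "z \<in> beauville_Sigma (alt_group n) x y \<longleftrightarrow>
    (\<exists>i\<in>{1..order (alt_group n)}. \<exists>g\<in>carrier (alt_group n). \<exists>u\<in>{x, y, x \<circ> y}.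
      z = g \<circ> (u ^^ i) \<circ> inv' g)"
  unfolding beauville_Sigma_def
  by (auto simp: alt_group_pow alt_group_mult alt_group_inv_equality)

text \<open>An element common to both sets is conjugate to a power from each pair, so these powers
  have equally many fixed points; \<open>fp\<close> makes this number n, and a permutation of n
  points with n fixed points is the identity.\<close>

lemma beauville_structure_altI:
  assumes x: "x1 \<in> carrier (alt_group n)" "y1 \<in> carrier (alt_group n)"
      "x2 \<in> carrier (alt_group n)" "y2 \<in> carrier (alt_group n)"
    and gen: "generate (alt_group n) {x1, y1} = carrier (alt_group n)"
      "generate (alt_group n) {x2, y2} = carrier (alt_group n)"
    and fp: "\<And>u v k l. u \<in> {x1, y1, x1 \<circ> y1} \<Longrightarrow> v \<in> {x2, y2, x2 \<circ> y2} \<Longrightarrow>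
      fixpts n (u ^^ k) = fixpts n (v ^^ l) \<Longrightarrow> fixpts n (u ^^ k) = n"
  shows "beauville_structure (alt_group n) {(x1, y1), (x2, y2)}"
proof -
  let ?G = "alt_group n"
  interpret group ?G by (rule alt_group_is_group)
  have one: "id \<in> beauville_Sigma ?G x y" if "x \<in> carrier ?G" "y \<in> carrier ?G" for x y
  proof -
    \<comment> \<open>The exponents start at 1, so the identity has to come from the exponent
      \<open>order ?G\<close>.\<close>
    have "x ^^ order ?G = id"
      using pow_order_eq_1[OF that(1)] by (simp add: alt_group_pow alt_group_one)
    moreover have "order ?G \<in> {1..order ?G}"
      using order_gt_0_iff_finite finite_alt_group by (simp add: Suc_leI)
    moreover have "id \<in> carrier ?G" using one_closed by (simp add: alt_group_one)
    ultimately show ?thesis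
      unfolding mem_beauville_Sigma_alt[OF that] by (intro bexI[where x="order ?G"] bexI[where x=id] bexI[where x=x]) auto
  qed
  have "z = id" if z1: "z \<in> beauville_Sigma ?G x1 y1" and z2: "z \<in> beauville_Sigma ?G x2 y2" for z
  proof -
    obtain i g u where 1: "g \<in> carrier ?G" "u \<in> {x1, y1, x1 \<circ> y1}" "z = g \<circ> (u ^^ i) \<circ> inv' g"
      using z1 unfolding mem_beauville_Sigma_alt[OF x(1,2)] by blast
    obtain j h v where 2: "h \<in> carrier ?G" "v \<in> {x2, y2, x2 \<circ> y2}" "z = h \<circ> (v ^^ j) \<circ> inv' h"
      using z2 unfolding mem_beauville_Sigma_alt[OF x(3,4)] by blast
    have u: "u permutes {1..n}"
      using 1(2) x alt_group_permutes permutes_compose by blast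
    have "fixpts n (u ^^ i) = fixpts n (v ^^ j)"
      using fixpts_conj[OF alt_group_permutes[OF 1(1)]] fixpts_conj[OF alt_group_permutes[OF 2(1)]] 1(3) 2(3)
      by metis
    then have "fixpts n (u ^^ i) = n" using fp 1(2) 2(2) by blast
    then have "u ^^ i = id"
      using fixpts_full permutes_funpow[OF u] by blast
    then show ?thesis
      using 1(1,3) alt_group_permutes permutes_inv_o(1) by auto
  qed
  then have "beauville_Sigma ?G x1 y1 \<inter> beauville_Sigma ?G x2 y2 = {id}"
    using one x by blast
  then show ?thesis
    unfolding beauville_structure_def using x gen by (auto simp: alt_group_one)
qed

section \<open>Strong reality through inverting permutations\<close>

text \<open>Inverse-free form of conjugating \<open>x\<close> to its inverse; concrete cases are
  then checked pointwise as \<open>x (r (x i)) = r i\<close>.\<close>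

definition inverts :: "('a \<Rightarrow> 'a) \<Rightarrow> ('a \<Rightarrow> 'a) \<Rightarrow> bool"
  where "inverts r x \<longleftrightarrow> x \<circ> r \<circ> x = r"

lemma inverts_conj:
  assumes "bij r" "bij x"
  shows "inverts r x \<longleftrightarrow> r \<circ> x \<circ> inv' r = inv' x"
proof
  assume "inverts r x"
  then have "x \<circ> (r \<circ> x \<circ> inv' r) = id"
    using assms(1) by (metis bij_is_surj comp_assoc inverts_def surj_iff)
  then show "r \<circ> x \<circ> inv' r = inv' x"
    using assms(2) by (metis bij_is_inj comp_assoc id_comp comp_id inv_o_cancel)
next
  assume "r \<circ> x \<circ> inv' r = inv' x"
  then have "x \<circ> (r \<circ> x \<circ> inv' r) \<circ> r = x \<circ> inv' x \<circ> r" by (simp add: comp_assoc)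
  then show "inverts r x"
    using assms by (metis bij_is_inj bij_is_surj comp_assoc comp_id id_comp inv_o_cancel inverts_def surj_iff)
qed

lemma conj_auto_alt_group:
  assumes r: "r permutes {1..n}"
  shows "(\<lambda>p \<in> carrier (alt_group n). r \<circ> p \<circ> inv' r) \<in> auto (alt_group n)"
proof -
  let ?G = "alt_group n"
  let ?c = "\<lambda>r p. r \<circ> p \<circ> inv' r :: nat \<Rightarrow> nat"
  have closed: "?c r p \<in> carrier ?G" if "r permutes {1..n}" "p \<in> carrier ?G" for r p
  proof -
    have pr: "permutation r" "permutation (inv' r)" "permutation p"
      using that permutes_imp_permutation permutes_inv alt_group_carrier' by blast+
    have "permutation (r \<circ> p)" using pr permutation_compose by blast
    then have "evenperm (?c r p)"
      using pr that(2) evenperm_inv[OF pr(1)] by (simp add: evenperm_comp alt_group_carrier)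
    moreover have "?c r p permutes {1..n}"
      using that by (simp add: alt_group_carrier permutes_compose permutes_inv)
    ultimately show ?thesis by (simp add: alt_group_carrier)
  qed
  have r': "inv' r permutes {1..n}" using r by (rule permutes_inv)
  have ii: "inv' (inv' r) = r" using r by (simp add: permutes_inv_inv)
  have io: "r \<circ> inv' r = id" "inv' r \<circ> r = id" using permutes_inv_o[OF r] by auto
  have iod: "r (inv' r i) = i" "inv' r (r i) = i" for i
    using permutes_inverses[OF r] by auto
  have "bij_betw (?c r) (carrier ?G) (carrier ?G)"
  proof (rule bij_betwI[where g = "?c (inv' r)"])
    show "?c r \<in> carrier ?G \<rightarrow> carrier ?G" using closed[OF r] by auto
    show "?c (inv' r) \<in> carrier ?G \<rightarrow> carrier ?G" using closed[OF r'] by auto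
  qed (auto simp: ii iod fun_eq_iff)
  then have "(\<lambda>p \<in> carrier ?G. ?c r p) \<in> Bij (carrier ?G)"
    by (simp add: Bij_def cong: bij_betw_cong)
  moreover have "(\<lambda>p \<in> carrier ?G. ?c r p) \<in> hom ?G ?G"
  proof (rule homI)
    fix p q assume pq: "p \<in> carrier ?G" "q \<in> carrier ?G"
    have "p \<circ> q \<in> carrier ?G"
      using pq group.is_monoid[OF alt_group_is_group] monoid.m_closed[of ?G p q] by (simp add: alt_group_mult)
    then show "(\<lambda>p \<in> carrier ?G. ?c r p) (p \<otimes>\<^bsub>?G\<^esub> q)
      = (\<lambda>p \<in> carrier ?G. ?c r p) p \<otimes>\<^bsub>?G\<^esub> (\<lambda>p \<in> carrier ?G. ?c r p) q"
      using pq by (simp add: alt_group_mult fun_eq_iff iod)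
  qed (use closed[OF r] in auto)
  ultimately show ?thesis by (simp add: auto_def)
qed

text \<open>Conjugation by \<open>r1\<close> serves as the automorphism and inverts the first pair
  outright; a further conjugation by \<open>r2 \<circ> inv' r1\<close> turns it into conjugation by
  \<open>r2\<close>. Equal parity makes this element even.\<close>

lemma strongly_real_altI:
  assumes x: "x1 \<in> carrier (alt_group n)" "y1 \<in> carrier (alt_group n)"
      "x2 \<in> carrier (alt_group n)" "y2 \<in> carrier (alt_group n)"
    and r: "r1 permutes {1..n}" "r2 permutes {1..n}" "evenperm r1 \<longleftrightarrow> evenperm r2"
    and inv: "inverts r1 x1" "inverts r1 y1" "inverts r2 x2" "inverts r2 y2"
  shows "strongly_real (alt_group n) {(x1, y1), (x2, y2)}"
proof -
  let ?G = "alt_group n"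
  let ?phi = "\<lambda>p \<in> carrier ?G. r1 \<circ> p \<circ> inv' r1"
  let ?g = "r2 \<circ> inv' r1"
  interpret group ?G by (rule alt_group_is_group)
  have bij: "bij r1" "bij r2" using r permutes_bij by auto
  have perm: "permutation r1" "permutation r2" "permutation (inv' r1)"
    using r permutes_imp_permutation permutes_inv by blast+
  have iod: "r1 (inv' r1 i) = i" "inv' r1 (r1 i) = i" for i
    using permutes_inverses[OF r(1)] by auto
  have g: "?g \<in> carrier ?G"
    using r perm evenperm_inv[OF perm(1)]
    by (auto simp: alt_group_carrier permutes_compose permutes_inv evenperm_comp)
  have one: "id \<in> carrier ?G" using one_closed by (simp add: alt_group_one)
  have ginv: "inv' ?g = r1 \<circ> inv' r2"
    using bij by (simp add: o_inv_distrib bij_imp_bij_inv inv_inv_eq)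
  have conj: "?g \<circ> (r1 \<circ> p \<circ> inv' r1) \<circ> inv' ?g = r2 \<circ> p \<circ> inv' r2" for p
    by (simp add: ginv fun_eq_iff iod)
  have e: "r \<circ> p \<circ> inv' r = inv' p" if "inverts r p" "p \<in> carrier ?G" "bij r" for r p
    using that inverts_conj permutes_bij alt_group_permutes by blast
  have "\<exists>\<phi>\<in>auto ?G. \<exists>g1\<in>carrier ?G. \<exists>g2\<in>carrier ?G.
        g1 \<otimes>\<^bsub>?G\<^esub> \<phi> x1 \<otimes>\<^bsub>?G\<^esub> inv\<^bsub>?G\<^esub> g1 = inv\<^bsub>?G\<^esub> x1 \<and>
        g1 \<otimes>\<^bsub>?G\<^esub> \<phi> y1 \<otimes>\<^bsub>?G\<^esub> inv\<^bsub>?G\<^esub> g1 = inv\<^bsub>?G\<^esub> y1 \<and>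
        g2 \<otimes>\<^bsub>?G\<^esub> \<phi> x2 \<otimes>\<^bsub>?G\<^esub> inv\<^bsub>?G\<^esub> g2 = inv\<^bsub>?G\<^esub> x2 \<and>
        g2 \<otimes>\<^bsub>?G\<^esub> \<phi> y2 \<otimes>\<^bsub>?G\<^esub> inv\<^bsub>?G\<^esub> g2 = inv\<^bsub>?G\<^esub> y2"
    using x bij inv
    by (intro bexI[of _ ?phi] bexI[of _ id] bexI[of _ ?g] conj_auto_alt_group[OF r(1)] one g)
      (simp_all add: alt_group_mult alt_group_inv_equality g one conj e)
  then show ?thesis
    unfolding strongly_real_def by blast
qed

text \<open>If one pair is inverted by a permutation, then the automorphism has to be conjugation by a
  permutation, because it is known on generators; so the other pair is inverted by a permutation as
  well.\<close>

lemma not_strongly_real_alt_aux: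
  assumes x: "x1 \<in> carrier (alt_group n)" "y1 \<in> carrier (alt_group n)"
      "x2 \<in> carrier (alt_group n)" "y2 \<in> carrier (alt_group n)"
    and gen: "generate (alt_group n) {x1, y1} = carrier (alt_group n)"
    and r: "r permutes {1..n}" "inverts r x1" "inverts r y1"
    and phi: "\<phi> \<in> auto (alt_group n)" "g1 \<in> carrier (alt_group n)" "g2 \<in> carrier (alt_group n)"
    and eq: "g1 \<circ> \<phi> x1 \<circ> inv' g1 = inv' x1" "g1 \<circ> \<phi> y1 \<circ> inv' g1 = inv' y1"
      "g2 \<circ> \<phi> x2 \<circ> inv' g2 = inv' x2" "g2 \<circ> \<phi> y2 \<circ> inv' g2 = inv' y2"
  shows "\<exists>h. h permutes {1..n} \<and> inverts h x2 \<and> inverts h y2"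
proof -
  let ?G = "alt_group n"
  interpret G: group ?G by (rule alt_group_is_group)
  have hom: "\<phi> \<in> hom ?G ?G" using phi(1) by (simp add: auto_def)
  interpret phi: group_hom ?G ?G \<phi>
    using hom by unfold_locales
  let ?c = "\<lambda>p \<in> carrier ?G. r \<circ> p \<circ> inv' r"
  let ?d = "\<lambda>p \<in> carrier ?G. g1 \<circ> p \<circ> inv' g1"
  have g: "g1 permutes {1..n}" "g2 permutes {1..n}" using phi alt_group_permutes by blast+
  have c: "?c \<in> hom ?G ?G" and d: "?d \<in> hom ?G ?G"
    using conj_auto_alt_group r(1) g(1) by (auto simp: auto_def)
  have phic: "\<phi> p \<in> carrier ?G" if "p \<in> carrier ?G" for p using that by simp
  have bij: "bij r" "bij g1" "bij g2" using r g permutes_bij by auto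
  interpret c: group_hom ?G ?G ?c using c by unfold_locales
  interpret d: group_hom ?G ?G ?d using d by unfold_locales
  have ri: "r \<circ> p \<circ> inv' r = inv' p" if "inverts r p" "p \<in> carrier ?G" for p
    using that inverts_conj bij permutes_bij alt_group_permutes by blast
  have base: "g1 \<circ> \<phi> h \<circ> inv' g1 = r \<circ> h \<circ> inv' r" if "h \<in> {x1, y1}" for h
    using that eq(1,2) ri[OF r(2) x(1)] ri[OF r(3) x(2)] by auto
  have base': "h \<in> carrier ?G \<and> ?d (\<phi> h) = ?c h" if "h \<in> {x1, y1}" for h
    using base[OF that] that x(1,2) phic by auto
  have agree: "?d (\<phi> p) = ?c p" if "p \<in> generate ?G {x1, y1}" for p
    using that
  proof (induction rule: generate.induct)
    case one
    then show ?case by (simp only: phi.hom_one d.hom_one c.hom_one)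
  next
    case (incl h)
    then show ?case using base' by blast
  next
    case (inv h)
    then have h: "h \<in> carrier ?G" "?d (\<phi> h) = ?c h" using base' by blast+
    show ?case by (simp only: phi.hom_inv[OF h(1)] d.hom_inv[OF phic[OF h(1)]] c.hom_inv[OF h(1)] h(2))
  next
    case (eng h1 h2)
    then have h: "h1 \<in> carrier ?G" "h2 \<in> carrier ?G" using gen by auto
    show ?case
      by (simp only: phi.hom_mult[OF h] d.hom_mult[OF phic[OF h(1)] phic[OF h(2)]] c.hom_mult[OF h] eng.IH)
  qed
  \<comment> \<open>On the group \<open>\<phi>\<close> is conjugation by
    \<open>inv' g1 \<circ> r\<close>; following it by conjugation by \<open>g2\<close> gives
    conjugation by \<open>?h\<close>.\<close>
  let ?h = "g2 \<circ> inv' g1 \<circ> r"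
  have "\<phi> p = inv' g1 \<circ> r \<circ> p \<circ> inv' r \<circ> g1" if "p \<in> carrier ?G" for p
  proof -
    have "g1 \<circ> \<phi> p \<circ> inv' g1 = r \<circ> p \<circ> inv' r"
      using agree[of p] that phic gen by simp
    then have "inv' g1 \<circ> (g1 \<circ> \<phi> p \<circ> inv' g1) \<circ> g1 = inv' g1 \<circ> (r \<circ> p \<circ> inv' r) \<circ> g1" by simp
    then show ?thesis using permutes_inverses[OF g(1)] by (simp add: fun_eq_iff)
  qed
  moreover have "inv' ?h = inv' r \<circ> g1 \<circ> inv' g2"
    using bij by (simp add: o_inv_distrib bij_imp_bij_inv inv_inv_eq bij_comp comp_assoc)
  ultimately have "?h \<circ> p \<circ> inv' ?h = g2 \<circ> \<phi> p \<circ> inv' g2" if "p \<in> carrier ?G" for p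
    using that by (simp add: fun_eq_iff)
  then have "?h \<circ> x2 \<circ> inv' ?h = inv' x2" "?h \<circ> y2 \<circ> inv' ?h = inv' y2"
    using x eq by auto
  moreover have h: "?h permutes {1..n}" using r g by (simp add: permutes_compose permutes_inv)
  ultimately have "inverts ?h x2" "inverts ?h y2"
    using x inverts_conj permutes_bij alt_group_permutes by blast+
  then show ?thesis using h by blast
qed

lemma not_strongly_real_altI:
  assumes x: "x1 \<in> carrier (alt_group n)" "y1 \<in> carrier (alt_group n)"
      "x2 \<in> carrier (alt_group n)" "y2 \<in> carrier (alt_group n)"
    and gen: "generate (alt_group n) {x1, y1} = carrier (alt_group n)"
    and r: "r permutes {1..n}" "inverts r x1" "inverts r y1"
    and no: "\<And>h. h permutes {1..n} \<Longrightarrow> inverts h x2 \<Longrightarrow> inverts h y2 \<Longrightarrow> False"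
  shows "\<not> strongly_real (alt_group n) {(x1, y1), (x2, y2)}"
proof
  let ?G = "alt_group n"
  assume "strongly_real ?G {(x1, y1), (x2, y2)}"
  then obtain a1 b1 a2 b2 \<phi> h1 h2 where B: "{(x1, y1), (x2, y2)} = {(a1, b1), (a2, b2)}"
    and phi: "\<phi> \<in> auto ?G" and h: "h1 \<in> carrier ?G" "h2 \<in> carrier ?G"
    and eq: "h1 \<otimes>\<^bsub>?G\<^esub> \<phi> a1 \<otimes>\<^bsub>?G\<^esub> inv\<^bsub>?G\<^esub> h1 = inv\<^bsub>?G\<^esub> a1"
      "h1 \<otimes>\<^bsub>?G\<^esub> \<phi> b1 \<otimes>\<^bsub>?G\<^esub> inv\<^bsub>?G\<^esub> h1 = inv\<^bsub>?G\<^esub> b1"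
      "h2 \<otimes>\<^bsub>?G\<^esub> \<phi> a2 \<otimes>\<^bsub>?G\<^esub> inv\<^bsub>?G\<^esub> h2 = inv\<^bsub>?G\<^esub> a2"
      "h2 \<otimes>\<^bsub>?G\<^esub> \<phi> b2 \<otimes>\<^bsub>?G\<^esub> inv\<^bsub>?G\<^esub> h2 = inv\<^bsub>?G\<^esub> b2"
    unfolding strongly_real_def by blast
  note aux = not_strongly_real_alt_aux[OF x gen r phi]
  \<comment> \<open>Strong reality may number the two pairs the other way; then \<open>h1\<close>
    and \<open>h2\<close> exchange roles.\<close>
  have "(a1, b1) = (x1, y1) \<and> (a2, b2) = (x2, y2) \<or> (a1, b1) = (x2, y2) \<and> (a2, b2) = (x1, y1)"
    using B by (metis doubleton_eq_iff)
  then have "\<exists>h. h permutes {1..n} \<and> inverts h x2 \<and> inverts h y2"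
    using aux[OF h] aux[OF h(2,1)] eq x h by (auto simp: alt_group_mult alt_group_inv_equality)
  then show False using no by blast
qed

section \<open>Generating alternating groups\<close>

lemma cycle3_rotate: "distinct [a, b, c] \<Longrightarrow> cycle_of_list [a, b, c] = cycle_of_list [b, c, a]"
  using cycle_of_list_rotate_independent[of "[a, b, c]" 1] by simp

lemma inv_cycle3: "inv' (cycle_of_list [a, b, c]) = cycle_of_list [c, b, a]"
  by (simp add: o_inv_distrib transpose_commute)

text \<open>Closure is phrased for plain functions, so that 3-cycles can be handled without the
  group operations; the instances are the generated subgroups of alternating groups.\<close>

locale perm_closed =
  fixes H :: "(nat \<Rightarrow> nat) set"
  assumes bij: "p \<in> H \<Longrightarrow> bij p"
    and comp: "p \<in> H \<Longrightarrow> q \<in> H \<Longrightarrow> p \<circ> q \<in> H"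
    and inv: "p \<in> H \<Longrightarrow> inv' p \<in> H"
begin

lemma conj_cycle:
  assumes "p \<in> H" "distinct cs" "cycle_of_list cs \<in> H"
  shows "cycle_of_list (map p cs) \<in> H"
  using conjugation_of_cycle[OF assms(2) bij[OF assms(1)]] comp inv assms by metis

lemma conj_cycle3:
  assumes "p \<in> H" "distinct [a, b, c]" "cycle_of_list [a, b, c] \<in> H"
  shows "cycle_of_list [p a, p b, p c] \<in> H" "distinct [p a, p b, p c]"
  using conj_cycle[OF assms] assms(2) bij[OF assms(1)] by (auto simp: bij_def inj_eq)

definition linked :: "nat \<Rightarrow> nat \<Rightarrow> bool"
  where "linked a b \<longleftrightarrow> a = b \<or> (\<exists>c. distinct [a, b, c] \<and> cycle_of_list [a, b, c] \<in> H)"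

lemma linked_refl [simp]: "linked a a"
  by (simp add: linked_def)

lemma cycle3_swap:
  assumes "distinct [a, b, c]" "cycle_of_list [a, b, c] \<in> H"
  shows "cycle_of_list [b, a, c] \<in> H"
proof -
  have "cycle_of_list [b, a, c] = inv' (cycle_of_list [a, b, c])"
    unfolding inv_cycle3 by (rule cycle3_rotate[symmetric]) (use assms(1) in auto)
  then show ?thesis using inv[OF assms(2)] by (simp only:)
qed

lemma cycle3_linked:
  assumes "distinct [a, b, c]" "cycle_of_list [a, b, c] \<in> H"
  shows "linked a b" "linked b c" "linked a c"
proof -
  show "linked a b" using assms linked_def by blast
  have 1: "cycle_of_list [b, c, a] \<in> H" using assms(2) unfolding cycle3_rotate[OF assms(1)] .
  have d: "distinct [b, c, a]" "distinct [c, a, b]" "distinct [a, c, b]" using assms(1) by auto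
  show "linked b c" using 1 d(1) unfolding linked_def by blast
  have "cycle_of_list [c, a, b] \<in> H" using 1 unfolding cycle3_rotate[OF d(1)] .
  from cycle3_swap[OF d(2) this] show "linked a c" using d(3) unfolding linked_def by blast
qed

lemma linked_sym: "linked a b \<Longrightarrow> linked b a"
  using cycle3_swap[of a b] unfolding linked_def by (metis distinct_length_2_or_more distinct_singleton)

lemma linked_image: "p \<in> H \<Longrightarrow> linked a b \<Longrightarrow> linked (p a) (p b)"
  unfolding linked_def using conj_cycle3 by blast

lemma cycle3_eval:
  assumes "distinct [a, b, c]"
  shows "cycle_of_list [a, b, c] a = b" "cycle_of_list [a, b, c] b = c" "cycle_of_list [a, b, c] c = a"
    and "z \<noteq> a \<Longrightarrow> z \<noteq> b \<Longrightarrow> z \<noteq> c \<Longrightarrow> cycle_of_list [a, b, c] z = z"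
  using assms by (auto simp: transpose_def)

text \<open>Conjugating \<open>(a b c)\<close> by \<open>(b d e)\<close> moves b to d and leaves a
  fixed, unless \<open>a = e\<close>, when \<open>(b d e)\<close> itself joins a and d.\<close>

lemma linked_trans:
  assumes "linked a b" "linked b d"
  shows "linked a d"
proof (cases "a = b \<or> b = d \<or> a = d")
  case True
  then show ?thesis using assms by auto
next
  case False
  obtain c where c: "distinct [a, b, c]" "cycle_of_list [a, b, c] \<in> H"
    using assms(1) False unfolding linked_def by blast
  obtain e where e: "distinct [b, d, e]" "cycle_of_list [b, d, e] \<in> H"
    using assms(2) False unfolding linked_def by blast
  show ?thesis
  proof (cases "a = e")
    case True
    then show ?thesis using cycle3_linked(2)[OF e] linked_sym by blast
  next
    case ne: False
    have "c \<noteq> a" using c(1) by auto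
    have "cycle_of_list [b, d, e] a = a" "cycle_of_list [b, d, e] b = d"
      using cycle3_eval[OF e(1)] ne False by blast+
    then show ?thesis
      using cycle3_linked(1)[OF conj_cycle3(2,1)[OF e(2) c]] by (simp only:)
  qed
qed

text \<open>A link only provides some third point e; conjugating by a 3-cycle \<open>(e c f)\<close>
  replaces e by c. When f is a or b, conjugating twice gives the 3-cycle on a, b, c with the
  opposite orientation, which is then inverted.\<close>

lemma cycle3_of_linked:
  assumes "distinct [a, b, c]" "linked a b" "linked b c"
  shows "cycle_of_list [a, b, c] \<in> H"
proof -
  obtain e where e: "distinct [a, b, e]" "cycle_of_list [a, b, e] \<in> H"
    using assms(1,2) unfolding linked_def by auto
  show ?thesis
  proof (cases "e = c")
    case True
    then show ?thesis using e by simp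
  next
    case False
    have "linked e c"
      using cycle3_linked(2)[OF e] assms(3) linked_sym linked_trans by blast
    then obtain f where f: "distinct [e, c, f]" "cycle_of_list [e, c, f] \<in> H"
      using False unfolding linked_def by blast
    let ?p = "cycle_of_list [e, c, f]"
    have ab: "a \<noteq> e" "a \<noteq> c" "b \<noteq> e" "b \<noteq> c" "a \<noteq> b" using assms(1) e(1) by auto
    note step = conj_cycle3[OF f(2)] 
    consider "f \<noteq> a" "f \<noteq> b" | "f = a" | "f = b" by blast
    then show ?thesis
    proof cases
      case 1
      have "?p a = a" "?p b = b" "?p e = c"
        using cycle3_eval[OF f(1)] ab 1 by metis+
      then show ?thesis using step(1)[OF e] by (simp only:)
    next
      case 2
      have "?p a = e" "?p b = b" "?p e = c" "?p c = a"
        using cycle3_eval[OF f(1)] ab 2 by metis+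
      then have "cycle_of_list [c, b, a] \<in> H"
        using step[OF step(2)[OF e] step(1)[OF e]] by (simp only:)
      then have "inv' (cycle_of_list [c, b, a]) \<in> H" by (rule inv)
      then show ?thesis unfolding inv_cycle3 .
    next
      case 3
      have "?p a = a" "?p b = e" "?p e = c" "?p c = b"
        using cycle3_eval[OF f(1)] ab 3 by metis+
      then have "cycle_of_list [a, c, b] \<in> H"
        using step[OF step(2)[OF e] step(1)[OF e]] by (simp only:)
      then have "inv' (cycle_of_list [a, c, b]) \<in> H" by (rule inv)
      then have "cycle_of_list [b, c, a] \<in> H" unfolding inv_cycle3 .
      then show ?thesis unfolding cycle3_rotate[OF assms(1)] .
    qed
  qed
qed

text \<open>The shift by one carries the first link along the interval, and transitivity chains the
  links.\<close>

lemma linked_interval: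
  assumes "x \<in> H" "\<And>i. k \<le> i \<Longrightarrow> i < n \<Longrightarrow> x i = Suc i" "linked k (Suc k)" "k \<le> a" "a \<le> n"
  shows "linked k a"
proof -
  have *: "linked i (Suc i)" if "k \<le> i" "i < n" for i
    using that
  proof (induction i rule: dec_induct)
    case base
    then show ?case using assms(3) by simp
  next
    case (step i)
    then show ?case using linked_image[OF assms(1), of i "Suc i"] assms(2)[of i] assms(2)[of "Suc i"] by simp
  qed
  from assms(4,5) show ?thesis
  proof (induction a rule: dec_induct)
    case (step i)
    then show ?case using *[of i] linked_trans[of k i "Suc i"] by simp
  qed simp
qed

end

lemma perm_closed_alt_subgroup:
  assumes "S \<subseteq> carrier (alt_group n)"
  shows "perm_closed (generate (alt_group n) S)"
proof -
  interpret group "alt_group n" by (rule alt_group_is_group)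
  let ?H = "generate (alt_group n) S"
  have sub: "subgroup ?H (alt_group n)" by (rule generate_is_subgroup[OF assms])
  have car: "p \<in> carrier (alt_group n)" if "p \<in> ?H" for p
    using subgroup.mem_carrier[OF sub that] .
  show ?thesis
  proof
    fix p q assume p: "p \<in> ?H"
    show "bij p" using alt_group_permutes[OF car[OF p]] permutes_bij by blast
    show "inv' p \<in> ?H"
      using subgroup.m_inv_closed[OF sub p] car[OF p] by (simp add: alt_group_inv_equality)
    assume "q \<in> ?H"
    then show "p \<circ> q \<in> ?H"
      using subgroup.m_closed[OF sub p] by (simp add: alt_group_mult)
  qed
qed

lemma generate_alt_groupI:
  assumes S: "S \<subseteq> carrier (alt_group n)"
    and linked: "\<And>a. a \<in> {1..n} \<Longrightarrow> perm_closed.linked (generate (alt_group n) S) b a"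
  shows "generate (alt_group n) S = carrier (alt_group n)"
proof -
  interpret group "alt_group n" by (rule alt_group_is_group)
  let ?H = "generate (alt_group n) S"
  interpret H: perm_closed ?H by (rule perm_closed_alt_subgroup[OF S])
  have sub: "subgroup ?H (alt_group n)" by (rule generate_is_subgroup[OF S])
  have "three_cycles n \<subseteq> ?H"
  proof
    fix p assume "p \<in> three_cycles n"
    then obtain cs where cs: "p = cycle_of_list cs" "cycle cs" "length cs = 3" "set cs \<subseteq> {1..n}"
      by auto
    obtain a1 a2 a3 where cs_def: "cs = [a1, a2, a3]"
      using stupid_lemma[OF cs(3)] by auto
    have "H.linked a1 a2" "H.linked a2 a3"
      using linked cs(4) H.linked_sym H.linked_trans unfolding cs_def by (meson list.set_intros subsetD)+
    then show "p \<in> ?H"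
      using H.cycle3_of_linked cs(1,2) unfolding cs_def by blast
  qed
  then have "generate (alt_group n) (three_cycles n) \<subseteq> ?H"
    by (rule generate_subgroup_incl[OF _ sub])
  then show ?thesis
    using alt_group_carrier_as_three_cycles[of n] subgroup.subset[OF sub] by blast
qed

section \<open>Rotations, reflections and cycles\<close>

definition rot :: "nat \<Rightarrow> nat \<Rightarrow> nat \<Rightarrow> nat"
  where "rot k n i = (if k \<le> i \<and> i < n then Suc i else if i = n \<and> k \<le> n then k else i)"

lemma rot_self [simp]: "rot k k = id"
  by (auto simp: rot_def)

lemma rot_Suc: "k \<le> n \<Longrightarrow> rot k (Suc n) = rot k n \<circ> transpose n (Suc n)"
  by (auto simp: rot_def transpose_def fun_eq_iff)

lemma rot_permutes:
  assumes "k \<le> n"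
  shows "rot k n permutes {k..n}"
  using assms
proof (induction n rule: dec_induct)
  case base
  then show ?case using permutes_id by (simp add: id_def)
next
  case (step n)
  have "rot k n permutes {k..Suc n}"
    by (rule permutes_subset[OF step.IH]) auto
  moreover have "transpose n (Suc n) permutes {k..Suc n}"
    using step by (intro permutes_swap_id) auto
  ultimately show ?case
    unfolding rot_Suc[OF step(1)] by (rule permutes_compose[rotated])
qed

lemma evenperm_rot:
  assumes "k \<le> n"
  shows "evenperm (rot k n) \<longleftrightarrow> even (n - k)"
  using assms
proof (induction n rule: dec_induct)
  case base
  then show ?case by (simp add: id_def)
next
  case (step n)
  have "permutation (rot k n)"
    using rot_permutes[OF step(1)] permutes_imp_permutation by blast
  then show ?case
    using step unfolding rot_Suc[OF step(1)]
    by (subst evenperm_comp) (auto simp: permutation_swap_id evenperm_swap Suc_diff_le)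
qed

section \<open>Reflections of an interval and their parity\<close>

definition flip :: "nat \<Rightarrow> nat \<Rightarrow> nat \<Rightarrow> nat"
  where "flip a n i = (if a \<le> i \<and> i \<le> n then a + n - i else i)"

lemma flip_permutes: "flip a n permutes {a..n}"
  by (rule bij_imp_permutes[OF bij_betwI[where g = "flip a n"]]) (auto simp: flip_def)

text \<open>Reversing m + 1 points is a product of \<open>(m + 1) div 2\<close> disjoint
  transpositions; the induction peels off the outermost one.\<close>

lemma evenperm_flip: "evenperm (flip a (a + m)) \<longleftrightarrow> even ((m + 1) div 2)"
proof (induction m arbitrary: a rule: nat_induct2)
  case 0
  have "flip a (a + 0) = id" by (auto simp: flip_def fun_eq_iff)
  then show ?case by simp
next
  case 1
  have "flip a (a + 1) = transpose a (a + 1)" by (auto simp: flip_def transpose_def fun_eq_iff)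
  then show ?case by (simp only: evenperm_swap) simp
next
  case (step m)
  have "flip a (a + (m + 2)) = transpose a (a + (m + 2)) \<circ> flip (a + 1) (a + 1 + m)"
    by (auto simp: flip_def transpose_def fun_eq_iff)
  moreover have "permutation (flip (a + 1) (a + 1 + m))"
    using flip_permutes permutes_imp_permutation by blast
  ultimately have "evenperm (flip a (a + (m + 2))) \<longleftrightarrow> \<not> evenperm (flip (a + 1) (a + 1 + m))"
    by (simp only: evenperm_comp permutation_swap_id evenperm_swap) simp
  then show ?case using step[of "a + 1"] by simp
qed

lemma evenperm_flip_shift:
  assumes "a + 1 < n"
  shows "evenperm (flip (a + 2) n) \<longleftrightarrow> \<not> evenperm (flip a n)"
proof -
  obtain m where m: "n = a + 2 + m"
    using assms by (metis Suc_leI add_2_eq_Suc' le_Suc_ex add_Suc_right add.right_neutral One_nat_def)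
  show ?thesis
    using evenperm_flip[of "a + 2" m] evenperm_flip[of a "m + 2"] unfolding m by (simp add: ac_simps)
qed

lemma evenperm_cycle:
  assumes "distinct cs" "cs \<noteq> []"
  shows "evenperm (cycle_of_list cs) \<longleftrightarrow> odd (length cs)"
  using evenperm_unique[OF swapidseq_ext_imp_swapidseq[OF swapidseq_ext_of_cycles[OF assms(1)]] refl] assms(2)
  by (cases cs) auto

lemma cycle_in_alt_group:
  assumes "distinct cs" "odd (length cs)" "set cs \<subseteq> {1..n}"
  shows "cycle_of_list cs \<in> carrier (alt_group n)"
  using permutes_subset[OF cycle_permutes assms(3)] evenperm_cycle[OF assms(1)] assms(2)
  unfolding alt_group_carrier by fastforce

lemma single_orbit_cycle:
  assumes "distinct cs"
  shows "single_orbit (cycle_of_list cs) (set cs)"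
proof (rule single_orbitI)
  fix b assume "b \<in> set cs"
  then obtain j where j: "j < length cs" "b = cs ! j" by (auto simp: in_set_conv_nth)
  then have "rotate j cs ! 0 = b" by (subst nth_rotate) auto
  then have "(cycle_of_list cs ^^ j) (cs ! 0) = b"
    using cyclic_rotation[OF assms, of j] j(1) by (metis bot_nat_0.not_eq_extremum length_map nth_map not_less0)
  then show "reaches (cycle_of_list cs) (cs ! 0) b" unfolding reaches_def by blast
qed

lemma fixpts_cycle_funpow:
  assumes "distinct cs" "set cs \<subseteq> {1..n}"
  shows "fixpts n (cycle_of_list cs ^^ k) \<in> {n - length cs, n}"
proof -
  have "fixpts n (cycle_of_list cs ^^ k) \<in>
      {card ({1..n} - set cs), card ({1..n} - set cs) + card (set cs), card ({1..n} - set cs) + card ({} :: nat set), n}"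
    by (rule fixpts_funpow[OF permutes_subset[OF cycle_permutes assms(2)] single_orbit_cycle[OF assms(1)] single_orbit_empty])
      (use assms in \<open>auto intro: id_outside_supp\<close>)
  moreover have "card ({1..n} - set cs) = n - length cs"
    using assms by (simp add: card_Diff_subset distinct_card)
  moreover have "length cs \<le> n"
    using assms card_mono[OF _ assms(2)] by (simp add: distinct_card)
  ultimately show ?thesis using assms(1) by (auto simp: distinct_card)
qed

lemma single_orbit_rot: "single_orbit (rot k n) {k..n}"
  by (rule single_orbitI[of _ _ k], rule reaches_interval[of k n]) (auto simp: rot_def)

lemma fixpts_rot_funpow:
  assumes "1 \<le> k" "k \<le> n"
  shows "fixpts n (rot k n ^^ j) \<in> {k - 1, n}"
proof -
  have "fixpts n (rot k n ^^ j) \<in>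
      {card {1..<k}, card {1..<k} + card {k..n}, card {1..<k} + card ({} :: nat set), n}"
    by (rule fixpts_funpow[OF permutes_subset[OF rot_permutes[OF assms(2)]] single_orbit_rot single_orbit_empty])
      (use assms in \<open>auto simp: rot_def\<close>)
  then show ?thesis using assms by auto
qed

lemma rot_in_alt_group: "1 \<le> k \<Longrightarrow> k \<le> n \<Longrightarrow> even (n - k) \<Longrightarrow> rot k n \<in> carrier (alt_group n)"
  using permutes_subset[OF rot_permutes[of k n], of "{1..n}"] by (auto simp: alt_group_carrier evenperm_rot)

section \<open>A rotation and a 3-cycle\<close>

text \<open>The product of \<open>(1 2 ... n)\<close> and \<open>(1 2 d)\<close> is again an
  n-cycle, running 1, 3, 2, 4, 5, ... for \<open>d = 3\<close> and 1, 3, 4, 2, 5, ... for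
  \<open>d = 4\<close>. Hence both choices of d have the same list of fixed-point counts and differ
  only in symmetry.\<close>

lemma odd_cycle_pair:
  fixes n :: nat
  assumes n: "odd n" "n > 5" and d: "d \<in> {3, 4}"
  defines "x \<equiv> rot 1 n" and "c \<equiv> cycle_of_list [1, 2, d]"
  shows odd_cycle_pair_carrier: "x \<in> carrier (alt_group n)" "c \<in> carrier (alt_group n)"
    and odd_cycle_pair_generate: "generate (alt_group n) {x, c} = carrier (alt_group n)"
    and odd_cycle_pair_fixpts: "u \<in> {x, c, x \<circ> c} \<Longrightarrow> fixpts n (u ^^ k) \<in> {0, n - 3, n}"
proof -
  show x: "x \<in> carrier (alt_group n)"
    unfolding x_def using n by (intro rot_in_alt_group) auto
  show c: "c \<in> carrier (alt_group n)"
    unfolding c_def using n d by (intro cycle_in_alt_group) auto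
  let ?H = "generate (alt_group n) {x, c}"
  interpret H: perm_closed ?H
    using x c by (intro perm_closed_alt_subgroup) auto
  have xc: "x \<in> ?H" "c \<in> ?H" by (auto intro: generate.incl)
  have "H.linked 1 2"
    using H.cycle3_linked(1)[of 1 2 d, folded c_def] xc(2) d by auto
  then have l: "H.linked 1 (Suc 1)" by (simp only: Suc_1)
  have "x i = Suc i" if "1 \<le> i" "i < n" for i using that by (simp add: x_def rot_def)
  from H.linked_interval[OF xc(1) this l] have "H.linked 1 a" if "a \<in> {1..n}" for a
    using that by simp
  then show "generate (alt_group n) {x, c} = carrier (alt_group n)"
    using x c by (intro generate_alt_groupI) auto
  show "fixpts n (u ^^ k) \<in> {0, n - 3, n}" if u: "u \<in> {x, c, x \<circ> c}"
  proof -
    have "fixpts n (x ^^ k) \<in> {0, n}"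
      using fixpts_rot_funpow[of 1 n k] n unfolding x_def by simp
    moreover have "fixpts n (c ^^ k) \<in> {n - 3, n}"
      using fixpts_cycle_funpow[of "[1, 2, d]" n k] n d unfolding c_def by auto
    moreover have "fixpts n ((x \<circ> c) ^^ k) \<in> {0, n}"
    proof -
      have v: "(x \<circ> c) 1 = 3" "(x \<circ> c) 3 = (if d = 3 then 2 else 4)" "(x \<circ> c) 2 = d + 1"
        "(x \<circ> c) 4 = (if d = 3 then 5 else 2)"
        using d n by (auto simp: x_def c_def rot_def transpose_def)
      have s: "(x \<circ> c) i = Suc i" if "5 \<le> i" "i < n" for i
        using d n that by (auto simp: x_def c_def rot_def transpose_def)
      have r3: "reaches (x \<circ> c) 1 3" using v(1) by (rule reaches_first)
      have r2: "reaches (x \<circ> c) 1 2" and r4: "reaches (x \<circ> c) 1 4" and r5: "reaches (x \<circ> c) 1 5"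
      proof -
        have "reaches (x \<circ> c) 1 2 \<and> reaches (x \<circ> c) 1 4 \<and> reaches (x \<circ> c) 1 5"
        proof (cases "d = 3")
          case True
          with v have v: "(x \<circ> c) 3 = 2" "(x \<circ> c) 2 = 4" "(x \<circ> c) 4 = 5" by simp_all
          have 2: "reaches (x \<circ> c) 1 2" using r3 v(1) by (rule reaches_step)
          have 4: "reaches (x \<circ> c) 1 4" using 2 v(2) by (rule reaches_step)
          have "reaches (x \<circ> c) 1 5" using 4 v(3) by (rule reaches_step)
          then show ?thesis using 2 4 by blast
        next
          case False
          with v d have v: "(x \<circ> c) 3 = 4" "(x \<circ> c) 4 = 2" "(x \<circ> c) 2 = 5" by simp_all
          have 4: "reaches (x \<circ> c) 1 4" using r3 v(1) by (rule reaches_step)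
          have 2: "reaches (x \<circ> c) 1 2" using 4 v(2) by (rule reaches_step)
          have "reaches (x \<circ> c) 1 5" using 2 v(3) by (rule reaches_step)
          then show ?thesis using 2 4 by blast
        qed
        then show "reaches (x \<circ> c) 1 2" "reaches (x \<circ> c) 1 4" "reaches (x \<circ> c) 1 5" by auto
      qed
      have "single_orbit (x \<circ> c) {1..n}"
      proof (rule single_orbitI[of _ _ 1])
        fix b assume "b \<in> {1..n}"
        then consider "b = 1" | "b = 2" | "b = 3" | "b = 4" | "5 \<le> b" "b \<le> n" by force
        then show "reaches (x \<circ> c) 1 b"
          by cases (use r2 r3 r4 reaches_interval[OF s r5] in auto)
      qed
      then have "fixpts n ((x \<circ> c) ^^ k) \<in> {card ({} :: nat set), card ({} :: nat set) + card {1..n},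
          card ({} :: nat set) + card ({} :: nat set), n}"
        using permutes_compose[OF alt_group_permutes[OF c] alt_group_permutes[OF x]]
        by (intro fixpts_funpow[where A = "{1..n}" and B = "{}" and C = "{}"]) auto
      then show ?thesis by auto
    qed
    ultimately show ?thesis using u by auto
  qed
qed

text \<open>For even n the n-cycle is odd, so the rotation leaves out 1 and the 3-cycle brings it
  in. The product is an (n-1)-cycle fixing 3. All counts other than n are odd, which separates this
  pair from one with even counts.\<close>

lemma even_cycle_pair:
  fixes n :: nat
  assumes n: "even n" "n > 5"
  defines "x \<equiv> rot 2 n" and "c \<equiv> cycle_of_list [1, 3, 2 :: nat]"
  shows even_cycle_pair_carrier: "x \<in> carrier (alt_group n)" "c \<in> carrier (alt_group n)"
    and even_cycle_pair_generate: "generate (alt_group n) {x, c} = carrier (alt_group n)"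
    and even_cycle_pair_fixpts: "u \<in> {x, c, x \<circ> c} \<Longrightarrow> fixpts n (u ^^ k) \<in> {1, n - 3, n}"
proof -
  show x: "x \<in> carrier (alt_group n)"
    unfolding x_def using n by (intro rot_in_alt_group) auto
  show c: "c \<in> carrier (alt_group n)"
    unfolding c_def using n by (intro cycle_in_alt_group) auto
  let ?H = "generate (alt_group n) {x, c}"
  interpret H: perm_closed ?H
    using x c by (intro perm_closed_alt_subgroup) auto
  have xc: "x \<in> ?H" "c \<in> ?H" by (auto intro: generate.incl)
  have l: "H.linked 1 3" "H.linked 3 2" "H.linked 1 2"
    using H.cycle3_linked[of 1 3 2, folded c_def] xc(2) by auto
  have "Suc 2 = 3" by simp
  then have l2: "H.linked 2 (Suc 2)" using H.linked_sym[OF l(2)] by (simp only:)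
  have "x i = Suc i" if "2 \<le> i" "i < n" for i using that by (simp add: x_def rot_def)
  note l2 = H.linked_interval[OF xc(1) this l2]
  have "H.linked 1 a" if "a \<in> {1..n}" for a
  proof (cases "a = 1")
    case False
    then have "H.linked 2 a" using that l2 by simp
    then show ?thesis using l(3) H.linked_trans by blast
  qed simp
  then show "generate (alt_group n) {x, c} = carrier (alt_group n)"
    using x c by (intro generate_alt_groupI) auto
  show "fixpts n (u ^^ k) \<in> {1, n - 3, n}" if u: "u \<in> {x, c, x \<circ> c}"
  proof -
    have "fixpts n (x ^^ k) \<in> {1, n}"
      using fixpts_rot_funpow[of 2 n k] n unfolding x_def by simp
    moreover have "fixpts n (c ^^ k) \<in> {n - 3, n}"
      using fixpts_cycle_funpow[of "[1, 3, 2]" n k] n unfolding c_def by auto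
    moreover have "fixpts n ((x \<circ> c) ^^ k) \<in> {1, n}"
    proof -
      have v: "(x \<circ> c) 2 = 1" "(x \<circ> c) 1 = 4" "(x \<circ> c) 3 = 3"
        using n by (auto simp: x_def c_def rot_def transpose_def)
      have s: "(x \<circ> c) i = Suc i" if "4 \<le> i" "i < n" for i
        using n that by (auto simp: x_def c_def rot_def transpose_def)
      have r1: "reaches (x \<circ> c) 2 1" using v(1) by (rule reaches_first)
      have r4: "reaches (x \<circ> c) 2 4" using r1 v(2) by (rule reaches_step)
      have "single_orbit (x \<circ> c) ({1..n} - {3})"
      proof (rule single_orbitI[of _ _ 2])
        fix b assume "b \<in> {1..n} - {3}"
        then consider "b = 1" | "b = 2" | "4 \<le> b" "b \<le> n" by force
        then show "reaches (x \<circ> c) 2 b"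
          by cases (use r1 reaches_interval[OF s r4] in auto)
      qed
      then have "fixpts n ((x \<circ> c) ^^ k) \<in> {card {3 :: nat}, card {3 :: nat} + card ({1..n} - {3}),
          card {3 :: nat} + card ({} :: nat set), n}"
        using permutes_compose[OF alt_group_permutes[OF c] alt_group_permutes[OF x]] v(3) n
        by (intro fixpts_funpow[where A = "{1..n} - {3}" and B = "{}" and C = "{3}"]) auto
      then show ?thesis using n by (auto simp: card_Diff_subset)
    qed
    ultimately show ?thesis using u by auto
  qed
qed

section \<open>Reflections that invert rotations\<close>

lemma invertsI: "(\<And>i. x (r (x i)) = r i) \<Longrightarrow> inverts r x"
  by (simp add: inverts_def fun_eq_iff)

lemma rot_eval:
  "k \<le> i \<Longrightarrow> i < n \<Longrightarrow> rot k n i = Suc i"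
  "k \<le> n \<Longrightarrow> rot k n n = k"
  "i < k \<or> n < i \<Longrightarrow> rot k n i = i"
  by (auto simp: rot_def)

lemma flip_eval:
  "a \<le> i \<Longrightarrow> i \<le> n \<Longrightarrow> flip a n i = a + n - i"
  "i < a \<or> n < i \<Longrightarrow> flip a n i = i"
  by (auto simp: flip_def)

text \<open>The hypotheses describe the reflection \<open>i \<mapsto> s - i\<close> of the polygon \<open>k, \<dots>, n\<close>.\<close>

lemma reflection_inverts_rot:
  assumes s: "k \<le> n" "2 * k \<le> s" "s \<le> n + k"
    and r1: "\<And>i. k \<le> i \<Longrightarrow> i + k \<le> s \<Longrightarrow> r i = s - i"
    and r2: "\<And>i. s < i + k \<Longrightarrow> i \<le> n \<Longrightarrow> r i = n + s + 1 - k - i"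
    and r3: "\<And>i. i < k \<or> n < i \<Longrightarrow> r i < k \<or> n < r i"
  shows "inverts r (rot k n)"
proof (rule invertsI)
  fix i
  consider "i < k \<or> n < i" | "k \<le> i" "Suc i + k \<le> s" "i < n" | "k \<le> i" "i + k = s" "i < n"
    | "s < i + k" "i < n" "k \<le> i" | "i = n" "k \<le> i"
    using s by linarith
  then show "rot k n (r (rot k n i)) = r i"
  proof cases
    case 1
    then show ?thesis using r3[OF 1] by (simp add: rot_eval)
  next
    case 2
    then have "r (Suc i) = s - Suc i" "r i = s - i" by (intro r1; linarith)+
    moreover have "rot k n (s - Suc i) = Suc (s - Suc i)"
      using 2 s by (intro rot_eval) linarith+
    moreover have "Suc (s - Suc i) = s - i" using 2 by linarith
    ultimately show ?thesis using 2 by (simp only: rot_eval)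
  next
    \<comment> \<open>Turning point \<open>i = s - k\<close>: from i to \<open>Suc i\<close> the
      reflection jumps from k to n, and the rotation closes this gap.\<close>
    case 3
    then have "r (Suc i) = n + s + 1 - k - Suc i" by (intro r2; linarith)
    also have "\<dots> = n" using 3 by linarith
    finally have "r (Suc i) = n" .
    moreover have "r i = k" using r1[of i] 3 s by simp
    ultimately show ?thesis using 3 s by (simp only: rot_eval)
  next
    case 4
    then have "r (Suc i) = n + s + 1 - k - Suc i" "r i = n + s + 1 - k - i" by (intro r2; linarith)+
    moreover have "rot k n (n + s + 1 - k - Suc i) = Suc (n + s + 1 - k - Suc i)"
      using 4 s by (intro rot_eval) linarith+
    moreover have "Suc (n + s + 1 - k - Suc i) = n + s + 1 - k - i" using 4 s by linarith
    ultimately show ?thesis using 4 by (simp only: rot_eval)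
  next
    \<comment> \<open>Here the rotation itself wraps from n to k; \<open>r n\<close> lies on the
      first branch exactly when \<open>s = n + k\<close>.\<close>
    case 5
    have "r k = s - k" using r1[of k] s by simp
    moreover have "rot k n (s - k) = r n"
    proof (cases "s = n + k")
      case True
      then show ?thesis using r1[of n] s by (simp add: rot_eval)
    next
      case False
      then have "rot k n (s - k) = Suc (s - k)" using s by (intro rot_eval) linarith+
      also have "\<dots> = n + s + 1 - k - n" using s by linarith
      also have "\<dots> = r n" using False s by (intro r2[symmetric]) linarith+
      finally show ?thesis .
    qed
    ultimately show ?thesis using 5 s by (simp only: rot_eval)
  qed
qed

text \<open>The permutation is the reflection of the n-gon sending i to 4 - i modulo n; its axis
  passes through 2, the middle point of \<open>(1 2 3)\<close>, so it reverses that cycle as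
  well.\<close>

lemma odd_cycle_pair_inverts:
  assumes n: "n > 5"
  shows "inverts (transpose 1 3 \<circ> flip 4 n) (rot 1 n)"
    and "inverts (transpose 1 3 \<circ> flip 4 n) (cycle_of_list [1, 2, 3])"
proof -
  let ?r = "transpose 1 3 \<circ> flip 4 n"
  have r4: "?r i = n + 4 - i" if "4 \<le> i" "i \<le> n" for i
    using that by (auto simp: flip_eval transpose_def)
  show "inverts ?r (rot 1 n)"
  proof (rule reflection_inverts_rot[where s = 4])
    fix i :: nat assume "1 \<le> i" "i + 1 \<le> 4"
    then have "i = 1 \<or> i = 2 \<or> i = 3" by linarith
    then show "?r i = 4 - i" using n by (auto simp: flip_eval)
  qed (use n r4 in \<open>auto simp: flip_eval\<close>)
  show "inverts ?r (cycle_of_list [1, 2, 3])"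
  proof (rule invertsI)
    fix i :: nat
    consider "i = 0" | "i = 1" | "i = 2" | "i = 3" | "4 \<le> i"
      by linarith
    then show "cycle_of_list [1, 2, 3] (?r (cycle_of_list [1, 2, 3] i)) = ?r i"
    proof cases
      case 5
      then have "4 \<le> flip 4 n i" by (auto simp: flip_def)
      then show ?thesis using 5 by simp
    qed (use n in \<open>simp_all add: flip_eval\<close>)
  qed
qed

text \<open>This is the reflection of the polygon 2, ..., n that swaps 2 and 3; it fixes 1 and
  thereby reverses \<open>(1 3 2)\<close>.\<close>

lemma even_cycle_pair_inverts:
  assumes n: "n > 5"
  shows "inverts (transpose 2 3 \<circ> flip 4 n) (rot 2 n)"
    and "inverts (transpose 2 3 \<circ> flip 4 n) (cycle_of_list [1, 3, 2])"
proof -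
  let ?r = "transpose 2 3 \<circ> flip 4 n"
  have r4: "?r i = n + 4 - i" if "4 \<le> i" "i \<le> n" for i
    using that by (auto simp: flip_eval transpose_def)
  show "inverts ?r (rot 2 n)"
  proof (rule reflection_inverts_rot[where s = 5])
    fix i :: nat assume "2 \<le> i" "i + 2 \<le> 5"
    then have "i = 2 \<or> i = 3" by linarith
    then show "?r i = 5 - i" using n by (auto simp: flip_eval)
  qed (use n r4 in \<open>auto simp: flip_eval\<close>)
  show "inverts ?r (cycle_of_list [1, 3, 2])"
  proof (rule invertsI)
    fix i :: nat
    consider "i = 0" | "i = 1" | "i = 2" | "i = 3" | "4 \<le> i"
      by linarith
    then show "cycle_of_list [1, 3, 2] (?r (cycle_of_list [1, 3, 2] i)) = ?r i"
    proof cases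
      case 5
      then have "4 \<le> flip 4 n i" by (auto simp: flip_def)
      then show ?thesis using 5 by simp
    qed (use n in \<open>simp_all add: flip_eval\<close>)
  qed
qed

text \<open>A permutation and its inverse move the same points, so inverting \<open>p\<close>
  preserves its support.\<close>

lemma inverts_mem_support:
  assumes "inverts h p" "inj h" "p i \<noteq> i"
  shows "p (h i) \<noteq> h i"
proof
  assume fixed: "p (h i) = h i"
  have e: "p \<circ> h \<circ> p = h" using assms(1) by (simp add: inverts_def)
  then have "inj (p \<circ> h \<circ> p)" using assms(2) by simp
  then have "inj p" by (rule inj_on_imageI2)
  moreover have "p (h (p i)) = p (h i)" using fun_cong[OF e, of i] fixed by simp
  ultimately have "h (p i) = h i" by (simp add: inj_eq)
  then show False using assms(2,3) by (simp add: inj_eq)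
qed

text \<open>Inverting the n-cycle forces \<open>h\<close> to be a reflection of the n-gon. The gaps
  between 1, 2 and 4 there are 1, 2 and n - 3, pairwise distinct, so no reflection preserves this
  support.\<close>

lemma odd_cycle_pair_not_inverted:
  assumes n: "n > 6" and h: "h permutes {1..n}" "inverts h (rot 1 n)" "inverts h (cycle_of_list [1, 2, 4])"
  shows False
proof -
  have e: "rot 1 n (h (rot 1 n i)) = h i" for i
    using h(2) unfolding inverts_def by (metis comp_apply)
  have s: "h i \<in> {1, 2, 4}" if "i \<in> {1, 2, 4}" for i
  proof -
    have "cycle_of_list [1, 2, 4] (h i) \<noteq> h i"
      using that by (intro inverts_mem_support[OF h(3) permutes_inj[OF h(1)]]) (auto simp: transpose_def)
    then have "h i \<in> set [1, 2, 4]" using id_outside_supp by metis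
    then show ?thesis by simp
  qed
  have "rot 1 n 1 = 2" "rot 1 n 2 = 3" "rot 1 n 3 = 4"
    using n by (simp_all add: rot_def)
  then have r: "rot 1 n (h 2) = h 1" "rot 1 n (h 3) = h 2" "rot 1 n (h 4) = h 3"
    using e[of 1] e[of 2] e[of 3] by simp_all
  have inj: "rot 1 n i = rot 1 n j \<Longrightarrow> i = j" for i j
    using permutes_inj[OF rot_permutes[of 1 n]] n by (simp add: inj_eq)
  have "rot 1 n n = 1" "rot 1 n (n - 1) = n" "rot 1 n 4 = 5"
    using n by (simp_all add: rot_def)
  note rots = this \<open>rot 1 n 1 = 2\<close> \<open>rot 1 n 2 = 3\<close> \<open>rot 1 n 3 = 4\<close>
  \<comment> \<open>\<open>h 2\<close> is followed by \<open>h 1\<close> on the polygon and both lie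
    in the support, whose only neighbours are 1 and 2.\<close>
  have "h 2 = 1 \<or> h 2 = 2 \<or> h 2 = 4" "h 1 = 1 \<or> h 1 = 2 \<or> h 1 = 4"
    using s[of 2] s[of 1] by auto
  then have "h 2 = 1"
    using r(1) rots(3,4,5) by auto
  then have "h 3 = n" using r(2) rots(1) inj by metis
  then have "h 4 = n - 1" using r(3) rots(2) inj by metis
  then show False using s[of 4] n by auto
qed

section \<open>A rotation of all but two points\<close>

text \<open>The cycle on 3, ..., n is odd exactly for even n; swapping the two remaining points then
  restores evenness.\<close>

definition trot :: "nat \<Rightarrow> nat \<Rightarrow> nat"
  where "trot n = (if even n then transpose 1 2 \<circ> rot 3 n else rot 3 n)"

lemma trot_eval:
  assumes "n > 5"
  shows "trot n 1 = (if even n then 2 else 1)" "trot n 2 = (if even n then 1 else 2)"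
    "3 \<le> i \<Longrightarrow> i < n \<Longrightarrow> trot n i = Suc i" "trot n n = 3" "3 \<le> i \<Longrightarrow> trot n i = rot 3 n i"
  using assms by (auto simp: trot_def rot_def transpose_def)

lemma trot_in_alt_group:
  assumes "n > 5"
  shows "trot n \<in> carrier (alt_group n)"
proof -
  have r: "rot 3 n permutes {1..n}"
    using assms by (intro permutes_subset[OF rot_permutes]) auto
  then have "permutation (rot 3 n)" using permutes_imp_permutation by blast
  then have "evenperm (trot n)"
    using assms by (auto simp only: trot_def evenperm_comp permutation_swap_id evenperm_swap evenperm_rot split: if_split) auto
  moreover have "trot n permutes {1..n}"
    using assms r by (auto simp: trot_def intro!: permutes_compose permutes_swap_id)
  ultimately show ?thesis by (simp add: alt_group_carrier)
qed

lemma fixpts_trot_funpow: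
  assumes n: "n > 5"
  shows "fixpts n (trot n ^^ k) \<in> (if even n then {0, 2, n - 2, n} else {2, n})"
proof -
  have p: "trot n permutes {1..n}" using trot_in_alt_group[OF n] by (rule alt_group_permutes)
  have A: "single_orbit (trot n) {3..n}"
    by (rule single_orbitI[of _ _ 3], rule reaches_interval[of 3 n]) (use n in \<open>auto simp: trot_eval\<close>)
  show ?thesis
  proof (cases "even n")
    case True
    have "single_orbit (trot n) {1, 2}"
      by (rule single_orbitI[of _ _ 1]) (use True trot_eval(1)[OF n] reaches_first[of "trot n" 1 2] in auto)
    moreover have "{1..n} = {3..n} \<union> {1, 2} \<union> {}" using n by auto
    ultimately
    have "fixpts n (trot n ^^ k) \<in> {card ({} :: nat set), card ({} :: nat set) + card {3..n},
        card ({} :: nat set) + card {1, 2 :: nat}, n}"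
      by (intro fixpts_funpow[OF p A]) auto
    then show ?thesis using True n by auto
  next
    case False
    have "trot n i = i" if "i \<in> {1, 2}" for i
      using that n False trot_eval(1,2)[OF n] by auto
    moreover have "{1..n} = {3..n} \<union> {} \<union> {1, 2}" using n by auto
    ultimately
    have "fixpts n (trot n ^^ k) \<in> {card {1, 2 :: nat}, card {1, 2 :: nat} + card {3..n},
        card {1, 2 :: nat} + card ({} :: nat set), n}"
      by (intro fixpts_funpow[OF p A single_orbit_empty]) auto
    then show ?thesis using False n by auto
  qed
qed

text \<open>The 5-cycle runs backwards through 5, 4, 3, so \<open>x \<circ> w\<close> fixes 4 and 5;
  the other points join in one cycle, apart from 1 when n is even.\<close>

lemma trot_pair5:
  fixes n :: nat
  assumes n: "n > 6"
  defines "x \<equiv> trot n" and "w \<equiv> cycle_of_list [1, 2, 5, 4, 3 :: nat]"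
  shows trot_pair5_carrier: "x \<in> carrier (alt_group n)" "w \<in> carrier (alt_group n)"
    and trot_pair5_generate: "generate (alt_group n) {x, w} = carrier (alt_group n)"
    and trot_pair5_fixpts: "u \<in> {x, w, x \<circ> w} \<Longrightarrow>
      fixpts n (u ^^ k) \<in> (if even n then {0, 2, 3, n - 2, n - 5, n} else {2, n - 5, n})"
proof -
  have n5: "n > 5" using n by simp
  show x: "x \<in> carrier (alt_group n)"
    unfolding x_def using n5 by (rule trot_in_alt_group)
  show w: "w \<in> carrier (alt_group n)"
    unfolding w_def using n by (intro cycle_in_alt_group) auto
  note xv = trot_eval[OF n5, folded x_def]
  have wv: "w 1 = 2" "w 2 = 5" "w 3 = 1" "w 4 = 3" "w 5 = 4" "w 6 = 6" "w 7 = 7"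
    by (simp_all add: w_def)
  have wi: "w i = i" if "5 < i" for i
    using that by (simp add: w_def)
  let ?H = "generate (alt_group n) {x, w}"
  interpret H: perm_closed ?H
    using x w by (intro perm_closed_alt_subgroup) auto
  have xw: "x \<in> ?H" "w \<in> ?H" by (auto intro: generate.incl)
  \<comment> \<open>The conjugate of \<open>w\<close> by \<open>x \<circ> x\<close>, which fixes 1
    and 2 and moves 3, 4, 5 to 5, 6, 7; here \<open>n > 6\<close> enters.\<close>
  define v where "v = cycle_of_list [1, 2, 7, 6, 5 :: nat]"
  have v: "v \<in> ?H"
  proof -
    have "cycle_of_list (map x [1, 2, 5, 4, 3]) \<in> ?H"
      using H.conj_cycle[OF xw(1), of "[1, 2, 5, 4, 3]"] xw(2) by (simp add: w_def)
    then have "cycle_of_list [x 1, x 2, 6, 5, 4] \<in> ?H"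
      using xv(3)[of 5] xv(3)[of 4] xv(3)[of 3] n by simp
    then have "cycle_of_list (map x [x 1, x 2, 6, 5, 4]) \<in> ?H"
      by (intro H.conj_cycle[OF xw(1)]) (use xv(1,2) in auto)
    then show ?thesis
      using xv(3)[of 6] xv(3)[of 5] xv(3)[of 4] xv(1,2) n by (simp add: v_def split: if_splits)
  qed
  have vv: "v 1 = 2" "v 2 = 7" "v 3 = 3" "v 4 = 4" "v 5 = 1" "v 6 = 5" "v 7 = 6"
    by (simp_all add: v_def)
  \<comment> \<open>\<open>?t\<close> is \<open>(1 6 4)(2 3)(5 7)\<close>, so its square is a
    3-cycle.\<close>
  let ?t = "w \<circ> w \<circ> (v \<circ> v \<circ> v)"
  have "?t \<circ> ?t \<in> ?H" using xw(2) v H.comp by blast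
  moreover have "?t \<circ> ?t = cycle_of_list [1, 4, 6]"
  proof
    fix i :: nat
    consider "i = 0 \<or> i > 7" | "i = 1" | "i = 2" | "i = 3" | "i = 4" | "i = 5" | "i = 6" | "i = 7" by linarith
    then show "(?t \<circ> ?t) i = cycle_of_list [1, 4, 6] i"
    proof cases
      case 1
      then have "w i = i" "v i = i" by (auto simp: w_def v_def)
      then show ?thesis using 1 by auto
    qed (use wv vv in simp_all)
  qed
  ultimately have c: "cycle_of_list [1, 4, 6 :: nat] \<in> ?H" by (simp only:)
  have l: "H.linked 1 4" "H.linked 4 6"
    using H.cycle3_linked[OF _ c] by auto
  have l2: "H.linked 2 3" "H.linked 3 6"
    using H.linked_image[OF xw(2) l(1)] H.linked_image[OF xw(2) l(2)] unfolding wv .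
  have l3: "H.linked 5 1" using H.linked_image[OF xw(2) l2(1)] unfolding wv .
  have l34: "H.linked 3 4" using l l2 H.linked_sym H.linked_trans by blast
  have "H.linked 3 a" if a: "a \<in> {1..n}" for a
  proof -
    consider "a = 1" | "a = 2" | "a \<ge> 3" using a unfolding atLeastAtMost_iff by linarith
    then show ?thesis
    proof cases
      case 3
      have "Suc 3 = 4" by simp
      then have "H.linked 3 (Suc 3)" using l34 by (simp only:)
      then show ?thesis using H.linked_interval[OF xw(1) xv(3)] a 3 by simp
    qed (use l l2 l34 H.linked_sym H.linked_trans in blast)+
  qed
  then show "generate (alt_group n) {x, w} = carrier (alt_group n)"
    using x w by (intro generate_alt_groupI) auto
  show "fixpts n (u ^^ k) \<in> (if even n then {0, 2, 3, n - 2, n - 5, n} else {2, n - 5, n})"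
    if u: "u \<in> {x, w, x \<circ> w}"
  proof -
    have "fixpts n (x ^^ k) \<in> (if even n then {0, 2, n - 2, n} else {2, n})"
      using fixpts_trot_funpow[OF n5] unfolding x_def .
    moreover have "fixpts n (w ^^ k) \<in> {n - 5, n}"
      using fixpts_cycle_funpow[of "[1, 2, 5, 4, 3]" n k] n unfolding w_def by auto
    moreover have "fixpts n ((x \<circ> w) ^^ k) \<in> (if even n then {3, n} else {2, n})"
    proof -
      have p: "x \<circ> w permutes {1..n}"
        using permutes_compose[OF alt_group_permutes[OF w] alt_group_permutes[OF x]] .
      have e: "(x \<circ> w) 2 = 6" "(x \<circ> w) 4 = 4" "(x \<circ> w) 5 = 5"
        using xv(3)[of 5] xv(3)[of 3] xv(3)[of 4] n by (simp_all add: wv)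
      have s: "(x \<circ> w) i = Suc i" if "6 \<le> i" "i < n" for i
        using that xv(3)[of i] wi[of i] by simp
      \<comment> \<open>The fixed points of \<open>x \<circ> w\<close>; for even n the transposition
        in \<open>x\<close> undoes the step of \<open>w\<close> from 1 to 2.\<close>
      define C where "C = (if even n then {1, 4, 5} else {4, 5 :: nat})"
      have C: "(x \<circ> w) i = i" if "i \<in> C" for i
        using that xv(1,2) wv e unfolding C_def by (auto split: if_splits)
      have r: "reaches (x \<circ> w) 3 2 \<and> (odd n \<longrightarrow> reaches (x \<circ> w) 3 1)"
      proof (cases "even n")
        case True
        then have "(x \<circ> w) 3 = 2" using xv(1) wv by simp
        then show ?thesis using True by (simp add: reaches_first)
      next
        case False
        then have e: "(x \<circ> w) 3 = 1" "(x \<circ> w) 1 = 2" using xv(1,2) wv by simp_all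
        have "reaches (x \<circ> w) 3 1" using e(1) by (rule reaches_first)
        moreover from this e(2) have "reaches (x \<circ> w) 3 2" by (rule reaches_step)
        ultimately show ?thesis by blast
      qed
      have r6: "reaches (x \<circ> w) 3 6" using reaches_step r e(1) by metis
      have "single_orbit (x \<circ> w) ({1..n} - C)"
      proof (rule single_orbitI[of _ _ 3])
        fix b assume b: "b \<in> {1..n} - C"
        then consider "b = 1" "odd n" | "b = 2" | "b = 3" | "6 \<le> b" "b \<le> n"
          unfolding C_def by (cases "even n") force+
        then show "reaches (x \<circ> w) 3 b"
          by cases (use r reaches_interval[OF s r6] in auto)
      qed
      then have "fixpts n ((x \<circ> w) ^^ k) \<in> {card C, card C + card ({1..n} - C),
          card C + card ({} :: nat set), n}"
        using p C n by (intro fixpts_funpow) (auto simp: C_def)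
      moreover have "C \<subseteq> {1..n}" using n by (auto simp: C_def)
      then have "card C + card ({1..n} - C) = n"
        by (metis card_Diff_subset card_atLeastAtMost card_mono diff_Suc_1 finite_atLeastAtMost
            finite_subset le_add_diff_inverse)
      moreover have "card C = (if even n then 3 else 2)" by (simp add: C_def)
      ultimately show ?thesis by auto
    qed
    ultimately show ?thesis using u by (auto split: if_splits)
  qed
qed

text \<open>The reflection of the polygon 3, ..., n about 4 swaps 3 and 5; swapping 1 and 2 in
  addition reverses \<open>(1 2 5 4 3)\<close> and respects the transposition in
  \<open>trot n\<close>.\<close>

lemma trot_pair5_inverts:
  assumes n: "n > 6"
  defines "r \<equiv> transpose 1 2 \<circ> transpose 3 5 \<circ> flip 6 n"
  shows "inverts r (trot n)" "inverts r (cycle_of_list [1, 2, 5, 4, 3])"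
proof -
  have v: "r 0 = 0" "r 1 = 2" "r 2 = 1" "r 3 = 5" "r 4 = 4" "r 5 = 3"
    unfolding r_def by (simp_all add: flip_eval)
  have r6: "r i = n + 6 - i" if "6 \<le> i" "i \<le> n" for i
    using that unfolding r_def by (auto simp: flip_eval transpose_def)
  have rn: "r i = i" if "n < i" for i
    using that n unfolding r_def by (auto simp: flip_eval transpose_def)
  have r3: "3 \<le> r i" if i: "3 \<le> i" for i
  proof -
    consider "i = 3" | "i = 4" | "i = 5" | "6 \<le> i" "i \<le> n" | "n < i" using i by linarith
    then show ?thesis by cases (use v r6 rn n in auto)
  qed
  have inv: "inverts r (rot 3 n)"
  proof (rule reflection_inverts_rot[where s = 8])
    fix i :: nat assume "3 \<le> i" "i + 3 \<le> 8"
    then have "i = 3 \<or> i = 4 \<or> i = 5" by linarith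
    then show "r i = 8 - i" using v by auto
  next
    fix i :: nat assume "i < 3 \<or> n < i"
    then consider "i = 0" | "i = 1" | "i = 2" | "n < i" by linarith
    then show "r i < 3 \<or> n < r i" by cases (use v rn in auto)
  qed (use n r6 in auto)
  show "inverts r (trot n)"
  proof (rule invertsI)
    fix i :: nat
    consider "i = 0" | "i = 1" | "i = 2" | "3 \<le> i" by linarith
    then show "trot n (r (trot n i)) = r i"
    proof cases
      case 4
      have "3 \<le> rot 3 n i" using 4 n by (auto simp: rot_def)
      then have "trot n (r (trot n i)) = rot 3 n (r (rot 3 n i))"
        using trot_eval(5)[of n] r3 n 4 by simp
      then show ?thesis using fun_cong[OF inv[unfolded inverts_def], of i] by simp
    next
      case 1
      then show ?thesis using v(1) by (simp add: trot_def rot_def)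
    qed (use v n trot_eval(1,2)[of n] in auto)
  qed
  show "inverts r (cycle_of_list [1, 2, 5, 4, 3])"
  proof (rule invertsI)
    fix i :: nat
    consider "i = 0" | "i = 1" | "i = 2" | "i = 3" | "i = 4" | "i = 5" | "6 \<le> i" by linarith
    then show "cycle_of_list [1, 2, 5, 4, 3] (r (cycle_of_list [1, 2, 5, 4, 3] i)) = r i"
    proof cases
      case 7
      have "6 \<le> r i"
        using r6[of i] rn[of i] 7 by (cases "i \<le> n") auto
      then show ?thesis using 7 by simp
    qed (use v in simp_all)
  qed
qed

text \<open>All nontrivial cycles of \<open>x\<close>, \<open>w\<close> and
  \<open>x \<circ> w\<close> have even length, so for even n every power has an even number of fixed
  points. The product is \<open>(1 5 4 6)\<close> times a cycle on the other n - 4 points.\<close>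

lemma trot_pair42:
  fixes n :: nat
  assumes n: "even n" "n > 5"
  defines "x \<equiv> trot n" and "w \<equiv> cycle_of_list [1, 4, 5, 3 :: nat] \<circ> transpose 2 6"
  shows trot_pair42_carrier: "x \<in> carrier (alt_group n)" "w \<in> carrier (alt_group n)"
    and trot_pair42_generate: "generate (alt_group n) {x, w} = carrier (alt_group n)"
    and trot_pair42_fixpts: "u \<in> {x, w, x \<circ> w} \<Longrightarrow> even (fixpts n (u ^^ k))"
    and trot_pair42_not_inverted: "h permutes {1..n} \<Longrightarrow> inverts h x \<Longrightarrow> inverts h w \<Longrightarrow> False"
proof -
  show x: "x \<in> carrier (alt_group n)"
    unfolding x_def using n(2) by (rule trot_in_alt_group)
  show w: "w \<in> carrier (alt_group n)"
  proof -
    have "evenperm w"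
      unfolding w_def
      by (subst evenperm_comp) (auto simp: permutation_of_cycle evenperm_cycle permutation_swap_id evenperm_swap
          simp del: cycle_of_list.simps)
    moreover have "cycle_of_list [1, 4, 5, 3] permutes {1..n}"
      using n by (intro permutes_subset[OF cycle_permutes]) auto
    then have "w permutes {1..n}"
      unfolding w_def using n by (intro permutes_compose permutes_swap_id) auto
    ultimately show ?thesis by (simp add: alt_group_carrier)
  qed
  note xp = alt_group_permutes[OF x] and wp = alt_group_permutes[OF w]
  note xv = trot_eval[OF n(2), folded x_def]
  have x12: "x 1 = 2" "x 2 = 1" using xv(1,2) n(1) by simp_all
  have x345: "x 3 = 4" "x 4 = 5" "x 5 = 6" using xv(3) n by simp_all
  have wv: "w 1 = 4" "w 2 = 6" "w 3 = 1" "w 4 = 5" "w 5 = 3" "w 6 = 2"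
    by (simp_all add: w_def)
  have wi: "w i = i" if "6 < i" for i
    using that by (simp add: w_def)
  let ?H = "generate (alt_group n) {x, w}"
  interpret H: perm_closed ?H
    using x w by (intro perm_closed_alt_subgroup) auto
  have xw: "x \<in> ?H" "w \<in> ?H" by (auto intro: generate.incl)
  \<comment> \<open>The conjugate by \<open>x\<close> of \<open>w \<circ> w\<close>, which is
    \<open>(1 5)(3 4)\<close>. The factor \<open>(2 6)\<close> of \<open>v\<close> cancels the
    transposition in \<open>w\<close>, and \<open>w \<circ> v\<close> becomes a 3-cycle.\<close>
  define v where "v = transpose 2 6 \<circ> transpose 4 (5 :: nat)"
  have vv: "v 1 = 1" "v 2 = 6" "v 3 = 3" "v 4 = 5" "v 5 = 4" "v 6 = 2"
    by (simp_all add: v_def)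
  have vx: "x \<circ> (w \<circ> w) = v \<circ> x"
  proof
    fix i :: nat
    consider "i = 0" | "i = 1" | "i = 2" | "i = 3" | "i = 4" | "i = 5" | "i = 6" | "6 < i" by linarith
    then show "(x \<circ> (w \<circ> w)) i = (v \<circ> x) i"
    proof cases
      case 1
      then show ?thesis using permutes_not_in[OF xp, of 0] permutes_not_in[OF wp, of 0] by (simp add: v_def)
    next
      case 7
      then have "x i \<noteq> x 1" "x i \<noteq> x 3" "x i \<noteq> x 4" "x i \<noteq> x 5"
        using permutes_inj[OF xp] by (auto simp: inj_eq)
      then have "v (x i) = x i" using x12 x345 by (auto simp: v_def)
      then show ?thesis using 7 wv by simp
    next
      case 8
      then have "x i \<noteq> x 1" "x i \<noteq> x 3" "x i \<noteq> x 4" "x i \<noteq> x 5"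
        using permutes_inj[OF xp] by (auto simp: inj_eq)
      then have "v (x i) = x i" using x12 x345 by (auto simp: v_def)
      then show ?thesis using wi[OF 8] by simp
    qed (use x12 x345 wv vv in simp_all)
  qed
  have "v = x \<circ> (w \<circ> w) \<circ> inv' x"
    unfolding vx using permutes_inv_o(1)[OF xp] by (simp add: comp_assoc)
  then have v: "v \<in> ?H" using xw H.comp H.inv by simp
  have "w \<circ> v = cycle_of_list [1, 4, 3]"
  proof
    fix i :: nat
    consider "i = 0" | "i = 1" | "i = 2" | "i = 3" | "i = 4" | "i = 5" | "i = 6" | "6 < i" by linarith
    then show "(w \<circ> v) i = cycle_of_list [1, 4, 3] i"
      by cases (use wv vv wi in \<open>simp_all add: w_def v_def\<close>)
  qed
  then have c: "cycle_of_list [1, 4, 3 :: nat] \<in> ?H" using H.comp[OF xw(2) v] by (simp only:)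
  have l: "H.linked 1 4" "H.linked 4 3" "H.linked 1 3"
    using H.cycle3_linked[OF _ c] by auto
  have l2: "H.linked 2 5"
    using H.linked_image[OF xw(1) l(1)] unfolding x12 x345 .
  have l3: "H.linked 4 5" using H.linked_image[OF xw(2) l(1)] unfolding wv .
  have l34: "H.linked 3 4" using l H.linked_sym by blast
  have "H.linked 3 a" if a: "a \<in> {1..n}" for a
  proof -
    consider "a = 1" | "a = 2" | "a \<ge> 3" using a unfolding atLeastAtMost_iff by linarith
    then show ?thesis
    proof cases
      case 3
      have "Suc 3 = 4" by simp
      then have "H.linked 3 (Suc 3)" using l34 by (simp only:)
      then show ?thesis using H.linked_interval[OF xw(1) xv(3)] a 3 by simp
    qed (use l l2 l3 H.linked_sym H.linked_trans in blast)+
  qed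
  then show "generate (alt_group n) {x, w} = carrier (alt_group n)"
    using x w by (intro generate_alt_groupI) auto
  show "even (fixpts n (u ^^ k))" if u: "u \<in> {x, w, x \<circ> w}"
  proof -
    have "even (fixpts n (x ^^ k))"
      using fixpts_trot_funpow[OF n(2), of k] n unfolding x_def by auto
    moreover have "even (fixpts n (w ^^ k))"
    proof -
      have r: "reaches w 1 4" using wv(1) by (rule reaches_first)
      have r': "reaches w 1 5" using r wv(4) by (rule reaches_step)
      have "reaches w 1 3" using r' wv(5) by (rule reaches_step)
      then have A: "single_orbit w {1, 4, 5, 3}"
        using r r' by (intro single_orbitI[of _ _ 1]) auto
      have B: "single_orbit w {2, 6}"
        using wv(2) by (intro single_orbitI[of _ _ 2]) (auto intro: reaches_first)
      have "fixpts n (w ^^ k) \<in> {card {7..n}, card {7..n} + card {1, 4, 5, 3 :: nat},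
          card {7..n} + card {2, 6 :: nat}, n}"
        using wi n by (intro fixpts_funpow[OF wp A B]) auto
      then show ?thesis using n by auto
    qed
    moreover have "even (fixpts n ((x \<circ> w) ^^ k))"
    proof -
      let ?A = "{1..n} - {1, 5, 4, 6}"
      have e: "(x \<circ> w) 1 = 5" "(x \<circ> w) 5 = 4" "(x \<circ> w) 4 = 6" "(x \<circ> w) 3 = 2" "(x \<circ> w) 2 = x 6"
        using wv x12 x345 by simp_all
      have r: "reaches (x \<circ> w) 1 5" using e(1) by (rule reaches_first)
      have r': "reaches (x \<circ> w) 1 4" using r e(2) by (rule reaches_step)
      have "reaches (x \<circ> w) 1 6" using r' e(3) by (rule reaches_step)
      then have B: "single_orbit (x \<circ> w) {1, 5, 4, 6}"
        using r r' by (intro single_orbitI[of _ _ 1]) auto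
      have r2: "reaches (x \<circ> w) 3 2" using e(4) by (rule reaches_first)
      have r6: "reaches (x \<circ> w) 3 (x 6)" using r2 e(5) by (rule reaches_step)
      have A: "single_orbit (x \<circ> w) ?A"
      proof (rule single_orbitI[of _ _ 3])
        fix b assume b: "b \<in> ?A"
        then consider "b = 2" | "b = 3" | "7 \<le> b" "b \<le> n" by force
        then show "reaches (x \<circ> w) 3 b"
        proof cases
          case 3
          then have "reaches (x \<circ> w) 3 7" using r6 xv(3)[of 6] by simp
          moreover have "(x \<circ> w) i = Suc i" if "7 \<le> i" "i < n" for i
            using that xv(3)[of i] wi[of i] by simp
          ultimately show ?thesis using 3 reaches_interval[of 7 n "x \<circ> w" 3 b] by blast
        qed (use r2 in auto)
      qed
      have "fixpts n ((x \<circ> w) ^^ k) \<in> {card ({} :: nat set), card ({} :: nat set) + card ?A,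
          card ({} :: nat set) + card {1, 5, 4, 6 :: nat}, n}"
        using n by (intro fixpts_funpow[OF permutes_compose[OF wp xp] A B]) auto
      moreover have "card ?A = n - 4" using n by (subst card_Diff_subset) auto
      ultimately show ?thesis using n by auto
    qed
    ultimately show ?thesis using u by auto
  qed
  show False if h: "h permutes {1..n}" "inverts h x" "inverts h w"
  proof -
    have ex: "x (h (x i)) = h i" and ew: "w (h (w i)) = h i" for i
      using h(2,3) unfolding inverts_def by (metis comp_apply)+
    have xi: "x i = x j \<Longrightarrow> i = j" and wi: "w i = w j \<Longrightarrow> i = j" for i j
      using permutes_inj[OF xp] permutes_inj[OF wp] by (auto simp: inj_eq)
    have 12: "x (h 1) = h 2" "x (h 2) = h 1" using ex[of 2] ex[of 1] x12 by simp_all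
    have "h 2 \<in> {1..n}" using permutes_in_image[OF h(1), of 2] n by simp
    then consider "h 2 = 1" | "h 2 = 2" | "3 \<le> h 2" "h 2 \<le> n" by force
    \<comment> \<open>2 lies on a 2-cycle of \<open>x\<close> and of \<open>w\<close>, and
      \<open>h\<close> respects cycle lengths; 1 lies on a 4-cycle of \<open>w\<close>, and the
      points from 3 on lie on a longer cycle of \<open>x\<close>.\<close>
    then have h2: "h 2 = 2"
    proof cases
      case 1
      then have "h 6 = 4" "w (h 6) = 1" using ew[of 6] ew[of 2] wv by simp_all
      then show ?thesis using wv by simp
    next
      case 3
      have "x (x (h 2)) = h 2" using 12 by simp
      moreover have "x (x (h 2)) \<noteq> h 2"
      proof -
        consider "h 2 < n - 1" | "h 2 = n - 1" | "h 2 = n" using 3 by linarith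
        then show ?thesis
          by cases (use xv(3)[of "h 2"] xv(3)[of "Suc (h 2)"] xv(4) x345 3 n in auto)
      qed
      ultimately show ?thesis by simp
    qed
    then have "h 6 = 6" "h 1 = 1" using ew[of 6] ew[of 2] 12 wv x12 by simp_all
    then have "w (h 4) = w 3" using ew[of 1] wv by simp
    then have h4: "h 4 = 3" by (rule wi)
    have "h 5 = x 6" using ex[of 5] \<open>h 6 = 6\<close> x345 by simp
    \<comment> \<open>Since \<open>h\<close> fixes 6 and reflects the long cycle, it sends 4 two
      steps past 6, while \<open>w\<close> forces \<open>h 4 = 3\<close>. Two steps past 6 lies 4 if
      \<open>n = 6\<close> and 8 otherwise.\<close>
    then have *: "x (x 6) = 3" using ex[of 4] x345 h4 by simp
    show False
    proof (cases "n = 6")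
      case True
      then show False using * xv(4) x345 by simp
    next
      case False
      then have "7 < n" using n by presburger
      then show False using * xv(3)[of 6] xv(3)[of 7] by simp
    qed
  qed
qed

section \<open>The exotic automorphism of the alternating group of degree 6\<close>

text \<open>One-line notation. Writing \<open>set [1..<7]\<close> for the domain lets
  \<open>code_simp\<close> evaluate the finite statements below.\<close>

definition perm6 :: "nat list \<Rightarrow> nat \<Rightarrow> nat"
  where "perm6 ps k = (if k \<in> set [1..<7] then ps ! (k - 1) else k)"

lemma perm6_out: "k \<notin> set [1..<7] \<Longrightarrow> perm6 ps k = k"
  unfolding perm6_def by (rule if_not_P)

text \<open>For \<open>i \<noteq> j\<close> this is the image of the transposition of \<open>i\<close> and \<open>j\<close>, a product of three
  disjoint transpositions, under the outer automorphism of the symmetric group which inverts the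
  two pairs of generators used below.\<close>

definition syn :: "nat \<Rightarrow> nat \<Rightarrow> nat \<Rightarrow> nat"
  where "syn i j = perm6 (
    [[[1, 2, 3, 4, 5, 6], [2, 1, 5, 6, 3, 4], [5, 4, 6, 2, 1, 3], [6, 5, 4, 3, 2, 1], [3, 6, 1, 5, 4, 2], [4, 3, 2, 1, 6, 5]],
     [[2, 1, 5, 6, 3, 4], [1, 2, 3, 4, 5, 6], [6, 3, 2, 5, 4, 1], [3, 4, 1, 2, 6, 5], [4, 5, 6, 1, 2, 3], [5, 6, 4, 3, 1, 2]],
     [[5, 4, 6, 2, 1, 3], [6, 3, 2, 5, 4, 1], [1, 2, 3, 4, 5, 6], [4, 6, 5, 1, 3, 2], [2, 1, 4, 3, 6, 5], [3, 5, 1, 6, 2, 4]],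
     [[6, 5, 4, 3, 2, 1], [3, 4, 1, 2, 6, 5], [4, 6, 5, 1, 3, 2], [1, 2, 3, 4, 5, 6], [5, 3, 2, 6, 1, 4], [2, 1, 6, 5, 4, 3]],
     [[3, 6, 1, 5, 4, 2], [4, 5, 6, 1, 2, 3], [2, 1, 4, 3, 6, 5], [5, 3, 2, 6, 1, 4], [1, 2, 3, 4, 5, 6], [6, 4, 5, 2, 3, 1]],
     [[4, 3, 2, 1, 6, 5], [5, 6, 4, 3, 1, 2], [3, 5, 1, 6, 2, 4], [2, 1, 6, 5, 4, 3], [6, 4, 5, 2, 3, 1], [1, 2, 3, 4, 5, 6]]]
    ! (i - 1) ! (j - 1))"

text \<open>For permutations this says that \<open>g'\<close> conjugates \<open>syn i j\<close> to
  \<open>syn (g i) (g j)\<close>, as \<open>g\<close> does with transpositions: the exotic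
  automorphism is described by its graph, with \<open>g'\<close> the image of
  \<open>g\<close>.\<close>

definition syn_compat :: "(nat \<Rightarrow> nat) \<Rightarrow> (nat \<Rightarrow> nat) \<Rightarrow> bool"
  where "syn_compat g g' \<longleftrightarrow> (\<forall>i\<in>{1..6}. \<forall>j\<in>{1..6}. g' \<circ> syn i j = syn (g i) (g j) \<circ> g')"

lemma set_1_6: "set [1..<7] = {1..6 :: nat}"
  by auto

lemma syn_compat_id: "syn_compat id id"
  by (simp add: syn_compat_def)

lemma syn_compat_comp:
  assumes "syn_compat g g'" "syn_compat h h'" "h permutes {1..6}"
  shows "syn_compat (g \<circ> h) (g' \<circ> h')"
  unfolding syn_compat_def
proof (intro ballI)
  fix i j :: nat assume ij: "i \<in> {1..6}" "j \<in> {1..6}"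
  then have h: "h i \<in> {1..6}" "h j \<in> {1..6}"
    using permutes_in_image[OF assms(3)] by blast+
  have "g' \<circ> h' \<circ> syn i j = g' \<circ> syn (h i) (h j) \<circ> h'"
    using assms(2) ij unfolding syn_compat_def by (metis comp_assoc)
  also have "\<dots> = syn (g (h i)) (g (h j)) \<circ> (g' \<circ> h')"
    using assms(1) h unfolding syn_compat_def by (metis comp_assoc)
  finally show "g' \<circ> h' \<circ> syn i j = syn ((g \<circ> h) i) ((g \<circ> h) j) \<circ> (g' \<circ> h')" by simp
qed

lemma syn_compat_inv:
  assumes "syn_compat g g'" "g permutes {1..6}" "g' permutes {1..6}"
  shows "syn_compat (inv' g) (inv' g')"
  unfolding syn_compat_def
proof (intro ballI)
  fix i j :: nat assume ij: "i \<in> {1..6}" "j \<in> {1..6}"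
  let ?i = "inv' g i" and ?j = "inv' g j"
  have h: "?i \<in> {1..6}" "?j \<in> {1..6}"
    using permutes_in_image[OF permutes_inv[OF assms(2)]] ij by blast+
  have "g' \<circ> syn ?i ?j = syn i j \<circ> g'"
    using assms(1) h permutes_inverses(1)[OF assms(2)] unfolding syn_compat_def by metis
  then have "inv' g' \<circ> (g' \<circ> syn ?i ?j) \<circ> inv' g' = inv' g' \<circ> (syn i j \<circ> g') \<circ> inv' g'" by simp
  then show "inv' g' \<circ> syn i j = syn ?i ?j \<circ> inv' g'"
    using permutes_inverses[OF assms(3)] by (simp add: fun_eq_iff)
qed

text \<open>Such a \<open>g'\<close> commutes with all \<open>syn i j\<close>. For each a other than
  1 two of these agree at 1 and differ at a, which forces \<open>g' 1 = 1\<close>; as they move 1 to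
  every point, every point is fixed.\<close>

lemma syn_compat_id_left:
  assumes g: "g' permutes {1..6}" and c: "syn_compat id g'"
  shows "g' = id"
proof -
  have e: "g' (syn i j k) = syn i j (g' k)" if "i \<in> {1..6}" "j \<in> {1..6}" for i j k
    using c that unfolding syn_compat_def by (metis comp_apply id_apply)
  have "g' 1 = 1"
  proof (rule ccontr)
    have "g' 1 \<in> {1..6}" using permutes_in_image[OF g] by simp
    moreover assume "g' 1 \<noteq> 1"
    ultimately have "g' 1 \<in> set [2..<7]" by auto
    moreover have "\<forall>a\<in>set [2..<7]. \<exists>i\<in>set [1..<7]. \<exists>j\<in>set [1..<7]. \<exists>k\<in>set [1..<7]. \<exists>l\<in>set [1..<7].
        syn i j 1 = syn k l 1 \<and> syn i j a \<noteq> syn k l a"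
      by code_simp
    ultimately show False using e unfolding set_1_6 by metis
  qed
  moreover have "\<forall>k\<in>set [1..<7]. \<exists>i\<in>set [1..<7]. \<exists>j\<in>set [1..<7]. syn i j 1 = k"
    by code_simp
  ultimately have "g' k = k" if "k \<in> {1..6}" for k
    using e that unfolding set_1_6 by metis
  then show ?thesis using permutes_not_in[OF g] by (metis eq_id_iff)
qed

text \<open>Equality of two entries of the table forces \<open>g i\<close> to be i or j for every j
  other than i; two choices of j leave only i.\<close>

lemma syn_compat_id_right:
  assumes g: "g permutes {1..6}" and c: "syn_compat g id"
  shows "g = id"
proof -
  have inj: "\<forall>i\<in>set [1..<7]. \<forall>j\<in>set [1..<7]. i \<noteq> j \<longrightarrow> (\<forall>a\<in>set [1..<7]. \<forall>b\<in>set [1..<7]. a \<noteq> b \<longrightarrow>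
      (\<forall>k\<in>set [1..<7]. syn i j k = syn a b k) \<longrightarrow> a = i \<or> a = j)"
    by code_simp
  have "g i \<in> {i, j}" if ij: "i \<in> {1..6}" "j \<in> {1..6}" "i \<noteq> j" for i j
  proof -
    have "syn i j = syn (g i) (g j)" using c ij unfolding syn_compat_def by simp
    moreover have "g i \<in> {1..6}" "g j \<in> {1..6}" "g i \<noteq> g j"
      using permutes_in_image[OF g] permutes_inj[OF g] ij by (auto simp: inj_eq simp del: atLeastAtMost_iff)
    ultimately show ?thesis using inj ij unfolding set_1_6 by auto
  qed note ij = this
  have "g i = i" if "i \<in> {1..6}" for i
  proof -
    define j k :: nat where "j = (if i = 1 then 2 else 1)" and "k = (if i = 3 then 2 else 3)"
    then have "j \<in> {1..6}" "k \<in> {1..6}" "i \<noteq> j" "i \<noteq> k" "j \<noteq> k" by auto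
    then show ?thesis using ij[OF \<open>i \<in> {1..6}\<close>, of j] ij[OF \<open>i \<in> {1..6}\<close>, of k] by auto
  qed
  then show ?thesis using permutes_not_in[OF g] by (metis eq_id_iff)
qed

lemma syn_compat_unique:
  assumes "g permutes {1..6}" "g' permutes {1..6}" "g'' permutes {1..6}" "syn_compat g g'" "syn_compat g g''"
  shows "g' = g''"
proof -
  have "syn_compat (g \<circ> inv' g) (g' \<circ> inv' g'')"
    using assms by (intro syn_compat_comp syn_compat_inv permutes_inv)
  then have "g' \<circ> inv' g'' = id"
    using syn_compat_id_left assms permutes_inv_o(1)[OF assms(1)] permutes_compose[OF permutes_inv] by metis
  then have "g' \<circ> (inv' g'' \<circ> g'') = g''" by (simp add: comp_assoc[symmetric])
  then show ?thesis using permutes_inv_o(2)[OF assms(3)] by simp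
qed

lemma syn_compat_inj:
  assumes "g permutes {1..6}" "h permutes {1..6}" "g' permutes {1..6}" "syn_compat g g'" "syn_compat h g'"
  shows "g = h"
proof -
  have "syn_compat (g \<circ> inv' h) (g' \<circ> inv' g')"
    using assms by (intro syn_compat_comp syn_compat_inv permutes_inv)
  then have "g \<circ> inv' h = id"
    using syn_compat_id_right assms permutes_inv_o(1)[OF assms(3)] permutes_compose[OF permutes_inv] by metis
  then have "g \<circ> (inv' h \<circ> h) = h" by (simp add: comp_assoc[symmetric])
  then show ?thesis using permutes_inv_o(2)[OF assms(2)] by simp
qed

text \<open>Compatibility passes to products and inverses, so images of two generators give each
  element exactly one image. The resulting automorphism inverts every element compatible with its
  inverse, in particular elements outside the generating pair.\<close>

lemma syn_compat_auto:
  assumes xy: "x \<in> carrier (alt_group 6)" "y \<in> carrier (alt_group 6)"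
    and gen: "generate (alt_group 6) {x, y} = carrier (alt_group 6)"
    and c: "syn_compat x (inv' x)" "syn_compat y (inv' y)"
  obtains \<phi> where "\<phi> \<in> auto (alt_group 6)"
    "\<And>g. g \<in> carrier (alt_group 6) \<Longrightarrow> syn_compat g (inv' g) \<Longrightarrow> \<phi> g = inv' g"
proof -
  let ?G = "alt_group 6"
  interpret group ?G by (rule alt_group_is_group)
  have one: "id \<in> carrier ?G" using one_closed by (simp add: alt_group_one)
  have mult: "g \<circ> h \<in> carrier ?G" if "g \<in> carrier ?G" "h \<in> carrier ?G" for g h
    using m_closed[OF that] by (simp add: alt_group_mult)
  have ex: "\<exists>g'\<in>carrier ?G. syn_compat g g'" if "g \<in> generate ?G {x, y}" for g
    using that
  proof (induction rule: generate.induct)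
    case one
    show ?case unfolding alt_group_one using syn_compat_id \<open>id \<in> carrier ?G\<close> by (rule bexI)
  next
    case (incl h)
    then show ?case using xy c alt_group_inv_closed by blast
  next
    case (inv h)
    then have h: "h \<in> carrier ?G" "syn_compat h (inv' h)" using xy c by auto
    note p = alt_group_permutes[OF h(1)]
    have "syn_compat (inv' h) (inv' (inv' h))"
      using h(2) p permutes_inv[OF p] by (rule syn_compat_inv)
    then show ?case
      using h(1) p by (auto simp: alt_group_inv_equality permutes_inv_inv)
  next
    case (eng h1 h2)
    then obtain h1' h2' where h: "h1' \<in> carrier ?G" "syn_compat h1 h1'" "h2' \<in> carrier ?G" "syn_compat h2 h2'"
      by blast
    have "h2 permutes {1..6}" using eng(2) gen alt_group_permutes by blast
    then have "syn_compat (h1 \<circ> h2) (h1' \<circ> h2')" using h syn_compat_comp by blast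
    then show ?case unfolding alt_group_mult using mult[OF h(1,3)] by (rule bexI)
  qed
  define \<phi> where "\<phi> = (\<lambda>g\<in>carrier ?G. SOME g'. g' \<in> carrier ?G \<and> syn_compat g g')"
  have phi: "\<phi> g \<in> carrier ?G" "syn_compat g (\<phi> g)" if "g \<in> carrier ?G" for g
  proof -
    have "\<exists>g'. g' \<in> carrier ?G \<and> syn_compat g g'" using ex[of g] gen that by blast
    from someI_ex[OF this] show "\<phi> g \<in> carrier ?G" "syn_compat g (\<phi> g)"
      using that by (auto simp: \<phi>_def)
  qed
  have phi_eq: "\<phi> g = g'" if "g \<in> carrier ?G" "g' \<in> carrier ?G" "syn_compat g g'" for g g'
    using syn_compat_unique[OF alt_group_permutes[OF that(1)] alt_group_permutes[OF phi(1)[OF that(1)]]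
      alt_group_permutes[OF that(2)] phi(2)[OF that(1)] that(3)] .
  have "inj_on \<phi> (carrier ?G)"
  proof (rule inj_onI)
    fix g h assume gh: "g \<in> carrier ?G" "h \<in> carrier ?G" "\<phi> g = \<phi> h"
    have "syn_compat h (\<phi> g)" using phi(2)[OF gh(2)] unfolding gh(3) .
    then show "g = h"
      by (rule syn_compat_inj[OF alt_group_permutes[OF gh(1)] alt_group_permutes[OF gh(2)]
            alt_group_permutes[OF phi(1)[OF gh(1)]] phi(2)[OF gh(1)]])
  qed
  moreover have "\<phi> ` carrier ?G \<subseteq> carrier ?G" using phi by blast
  ultimately have "bij_betw \<phi> (carrier ?G) (carrier ?G)"
    using endo_inj_surj[OF finite_alt_group] by (simp add: bij_betw_def)
  moreover have "\<phi> \<in> hom ?G ?G"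
  proof (rule homI)
    fix g h assume gh: "g \<in> carrier ?G" "h \<in> carrier ?G"
    have "syn_compat (g \<circ> h) (\<phi> g \<circ> \<phi> h)"
      by (rule syn_compat_comp[OF phi(2)[OF gh(1)] phi(2)[OF gh(2)] alt_group_permutes[OF gh(2)]])
    then show "\<phi> (g \<otimes>\<^bsub>?G\<^esub> h) = \<phi> g \<otimes>\<^bsub>?G\<^esub> \<phi> h"
      unfolding alt_group_mult by (rule phi_eq[OF mult[OF gh] mult[OF phi(1)[OF gh(1)] phi(1)[OF gh(2)]]])
  qed (use phi in auto)
  moreover have "\<phi> \<in> extensional (carrier ?G)" by (simp add: \<phi>_def)
  ultimately have "\<phi> \<in> auto ?G" by (simp add: auto_def Bij_def)
  moreover have "\<phi> g = inv' g" if "g \<in> carrier ?G" "syn_compat g (inv' g)" for g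
    using phi_eq[OF that(1) alt_group_inv_closed[OF that(1)] that(2)] .
  ultimately show ?thesis by (rule that)
qed

text \<open>Naming the inverse by a list \<open>qs\<close> turns compatibility into a finite
  evaluation; outside 1, ..., 6 everything is the identity.\<close>

lemma syn_compat_perm6:
  assumes g: "g = perm6 ps" and inv: "perm6 ps \<circ> perm6 qs = id" "perm6 qs \<circ> perm6 ps = id"
    and c: "\<forall>i\<in>set [1..<7]. \<forall>j\<in>set [1..<7]. \<forall>k\<in>set [1..<7].
      perm6 qs (syn i j k) = syn (perm6 ps i) (perm6 ps j) (perm6 qs k)"
  shows "syn_compat g (inv' g)"
proof -
  have "inv' g = perm6 qs"
    unfolding g using inv by (rule inv_unique_comp)
  moreover have "perm6 qs (syn i j k) = syn (perm6 ps i) (perm6 ps j) (perm6 qs k)"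
    if "i \<in> {1..6}" "j \<in> {1..6}" for i j k
  proof (cases "k \<in> set [1..<7]")
    case True
    then show ?thesis using c that unfolding set_1_6 by blast
  next
    case False
    then have "perm6 qs k = k" "syn i j k = k" "syn (perm6 ps i) (perm6 ps j) k = k"
      unfolding syn_def by (simp_all only: perm6_out[OF False])
    then show ?thesis by simp
  qed
  ultimately show ?thesis
    unfolding syn_compat_def g by (auto simp: fun_eq_iff)
qed

lemma perm6_eq_iff:
  "f = perm6 ps \<longleftrightarrow> (\<forall>k\<in>set [1..<7]. f k = ps ! (k - 1)) \<and> (\<forall>k. k \<notin> {1..6} \<longrightarrow> f k = k)"
  unfolding perm6_def fun_eq_iff set_1_6 by auto

lemma perm6_comp_id:
  assumes "\<forall>k\<in>set [1..<7]. perm6 ps (perm6 qs k) = k"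
  shows "perm6 ps \<circ> perm6 qs = id"
proof
  fix k
  show "(perm6 ps \<circ> perm6 qs) k = id k"
    using assms by (cases "k \<in> set [1..<7]") (auto simp: perm6_def)
qed

lemma upt_1_7: "[1..<7] = [1, 2, 3, 4, 5, 6 :: nat]"
  by code_simp

lemma ball_1_6: "(\<forall>k\<in>set [1..<7]. P k) \<longleftrightarrow> P 1 \<and> P 2 \<and> P 3 \<and> P 4 \<and> P 5 \<and> P (6 :: nat)"
  unfolding upt_1_7 by simp

section \<open>Elements of degree 6 inverted by the exotic automorphism\<close>

lemma trot6_compat: "syn_compat (trot 6) (inv' (trot 6))"
proof (rule syn_compat_perm6)
  show "trot 6 = perm6 [2, 1, 4, 5, 6, 3]"
    unfolding perm6_eq_iff ball_1_6 by (auto simp: trot_def rot_def transpose_def)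
  show "perm6 [2, 1, 4, 5, 6, 3] \<circ> perm6 [2, 1, 6, 3, 4, 5] = id"
    by (rule perm6_comp_id) code_simp
  show "perm6 [2, 1, 6, 3, 4, 5] \<circ> perm6 [2, 1, 4, 5, 6, 3] = id"
    by (rule perm6_comp_id) code_simp
  show "\<forall>i\<in>set [1..<7]. \<forall>j\<in>set [1..<7]. \<forall>k\<in>set [1..<7]. perm6 [2, 1, 6, 3, 4, 5] (syn i j k)
      = syn (perm6 [2, 1, 4, 5, 6, 3] i) (perm6 [2, 1, 4, 5, 6, 3] j) (perm6 [2, 1, 6, 3, 4, 5] k)"
    by code_simp
qed

lemma cycle42_compat:
  defines "w \<equiv> cycle_of_list [1, 4, 5, 3 :: nat] \<circ> transpose 2 6"
  shows "syn_compat w (inv' w)"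
proof (rule syn_compat_perm6)
  show "w = perm6 [4, 6, 1, 5, 3, 2]"
    unfolding perm6_eq_iff ball_1_6 w_def by (auto simp: transpose_def)
  show "perm6 [4, 6, 1, 5, 3, 2] \<circ> perm6 [3, 6, 5, 1, 4, 2] = id"
    by (rule perm6_comp_id) code_simp
  show "perm6 [3, 6, 5, 1, 4, 2] \<circ> perm6 [4, 6, 1, 5, 3, 2] = id"
    by (rule perm6_comp_id) code_simp
  show "\<forall>i\<in>set [1..<7]. \<forall>j\<in>set [1..<7]. \<forall>k\<in>set [1..<7]. perm6 [3, 6, 5, 1, 4, 2] (syn i j k)
      = syn (perm6 [4, 6, 1, 5, 3, 2] i) (perm6 [4, 6, 1, 5, 3, 2] j) (perm6 [3, 6, 5, 1, 4, 2] k)"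
    by code_simp
qed

lemma cycle5_compat:
  "syn_compat (cycle_of_list [2, 3, 6, 4, 5]) (inv' (cycle_of_list [2, 3, 6, 4, 5]))"
  "syn_compat (cycle_of_list [1, 2, 5, 3, 4]) (inv' (cycle_of_list [1, 2, 5, 3, 4]))"
proof -
  show "syn_compat (cycle_of_list [2, 3, 6, 4, 5]) (inv' (cycle_of_list [2, 3, 6, 4, 5]))"
  proof (rule syn_compat_perm6)
    show "cycle_of_list [2, 3, 6, 4, 5] = perm6 [1, 3, 6, 5, 2, 4]"
      unfolding perm6_eq_iff ball_1_6 by (auto simp: transpose_def)
    show "perm6 [1, 3, 6, 5, 2, 4] \<circ> perm6 [1, 5, 2, 6, 4, 3] = id"
      by (rule perm6_comp_id) code_simp
    show "perm6 [1, 5, 2, 6, 4, 3] \<circ> perm6 [1, 3, 6, 5, 2, 4] = id"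
      by (rule perm6_comp_id) code_simp
    show "\<forall>i\<in>set [1..<7]. \<forall>j\<in>set [1..<7]. \<forall>k\<in>set [1..<7]. perm6 [1, 5, 2, 6, 4, 3] (syn i j k)
        = syn (perm6 [1, 3, 6, 5, 2, 4] i) (perm6 [1, 3, 6, 5, 2, 4] j) (perm6 [1, 5, 2, 6, 4, 3] k)"
      by code_simp
  qed
  show "syn_compat (cycle_of_list [1, 2, 5, 3, 4]) (inv' (cycle_of_list [1, 2, 5, 3, 4]))"
  proof (rule syn_compat_perm6)
    show "cycle_of_list [1, 2, 5, 3, 4] = perm6 [2, 5, 4, 1, 3, 6]"
      unfolding perm6_eq_iff ball_1_6 by (auto simp: transpose_def)
    show "perm6 [2, 5, 4, 1, 3, 6] \<circ> perm6 [4, 1, 5, 3, 2, 6] = id"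
      by (rule perm6_comp_id) code_simp
    show "perm6 [4, 1, 5, 3, 2, 6] \<circ> perm6 [2, 5, 4, 1, 3, 6] = id"
      by (rule perm6_comp_id) code_simp
    show "\<forall>i\<in>set [1..<7]. \<forall>j\<in>set [1..<7]. \<forall>k\<in>set [1..<7]. perm6 [4, 1, 5, 3, 2, 6] (syn i j k)
        = syn (perm6 [2, 5, 4, 1, 3, 6] i) (perm6 [2, 5, 4, 1, 3, 6] j) (perm6 [4, 1, 5, 3, 2, 6] k)"
      by code_simp
  qed
qed

text \<open>The product of these 5-cycles is again a 5-cycle, so every count other than 6 is 1,
  against even counts for the partner pair.\<close>

lemma cycle5_pair:
  defines "u \<equiv> cycle_of_list [2, 3, 6, 4, 5 :: nat]" and "v \<equiv> cycle_of_list [1, 2, 5, 3, 4 :: nat]"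
  shows cycle5_pair_carrier: "u \<in> carrier (alt_group 6)" "v \<in> carrier (alt_group 6)"
    and cycle5_pair_generate: "generate (alt_group 6) {u, v} = carrier (alt_group 6)"
    and cycle5_pair_fixpts: "z \<in> {u, v, u \<circ> v} \<Longrightarrow> fixpts 6 (z ^^ k) \<in> {1, 6}"
proof -
  show u: "u \<in> carrier (alt_group 6)"
    unfolding u_def by (intro cycle_in_alt_group) auto
  show v: "v \<in> carrier (alt_group 6)"
    unfolding v_def by (intro cycle_in_alt_group) auto
  have uv: "u 1 = 1" "u 2 = 3" "u 3 = 6" "u 4 = 5" "u 5 = 2" "u 6 = 4"
    "v 1 = 2" "v 2 = 5" "v 3 = 4" "v 4 = 1" "v 5 = 3" "v 6 = 6"
    by (simp_all add: u_def v_def)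
  have out: "u i = i" "v i = i" if "i = 0 \<or> i > 6" for i
    using that by (auto simp: u_def v_def)
  let ?H = "generate (alt_group 6) {u, v}"
  interpret H: perm_closed ?H
    using u v by (intro perm_closed_alt_subgroup) auto
  have H: "u \<in> ?H" "v \<in> ?H" by (auto intro: generate.incl)
  \<comment> \<open>The long word supplies the 3-cycle for generation.\<close>
  have eq: "u \<circ> v \<circ> (u \<circ> u) \<circ> (v \<circ> v) = cycle_of_list [1, 5, 2]" "u \<circ> v = cycle_of_list [1, 3, 5, 6, 4]"
  proof -
    have "(u \<circ> v \<circ> (u \<circ> u) \<circ> (v \<circ> v)) i = cycle_of_list [1, 5, 2] i \<and>
      (u \<circ> v) i = cycle_of_list [1, 3, 5, 6, 4] i" for i :: nat
    proof -
      consider "i = 0 \<or> i > 6" | "i = 1" | "i = 2" | "i = 3" | "i = 4" | "i = 5" | "i = 6" by linarith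
      then show ?thesis
        by cases (use uv out[of i] in auto)
    qed
    then show "u \<circ> v \<circ> (u \<circ> u) \<circ> (v \<circ> v) = cycle_of_list [1, 5, 2]" "u \<circ> v = cycle_of_list [1, 3, 5, 6, 4]"
      by (auto simp only: fun_eq_iff)
  qed
  have "u \<circ> v \<circ> (u \<circ> u) \<circ> (v \<circ> v) \<in> ?H" using H H.comp by blast
  then have c: "cycle_of_list [1, 5, 2 :: nat] \<in> ?H" unfolding eq(1) .
  have l: "H.linked 1 5" "H.linked 5 2" "H.linked 1 2"
    using H.cycle3_linked[OF _ c] by auto
  have l2: "H.linked 2 3" using H.linked_image[OF H(1) l(2)] unfolding uv .
  have l3: "H.linked 3 6" using H.linked_image[OF H(1) l2] unfolding uv .
  have l4: "H.linked 6 4" using H.linked_image[OF H(1) l3] unfolding uv .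
  have "H.linked 1 a" if "a \<in> {1..6}" for a
  proof -
    have "a \<in> set [1..<7]" using that by auto
    then have "a = 1 \<or> a = 2 \<or> a = 3 \<or> a = 4 \<or> a = 5 \<or> a = 6" unfolding upt_1_7 by simp
    then show ?thesis using l l2 l3 l4 H.linked_trans H.linked_refl by metis
  qed
  then show "generate (alt_group 6) {u, v} = carrier (alt_group 6)"
    using u v by (intro generate_alt_groupI) auto
  show "fixpts 6 (z ^^ k) \<in> {1, 6}" if z: "z \<in> {u, v, u \<circ> v}"
    using z fixpts_cycle_funpow[of "[2, 3, 6, 4, 5]" 6 k] fixpts_cycle_funpow[of "[1, 2, 5, 3, 4]" 6 k]
      fixpts_cycle_funpow[of "[1, 3, 5, 6, 4]" 6 k]
    unfolding eq unfolding u_def v_def by (auto simp del: cycle_of_list.simps)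
qed

text \<open>The automorphism is built from \<open>x\<close> and \<open>w\<close> alone but also
  inverts \<open>u\<close> and \<open>v\<close>, so both conjugating elements can be the
  identity.\<close>

lemma strongly_real_alt6:
  defines "x \<equiv> trot 6" and "w \<equiv> cycle_of_list [1, 4, 5, 3 :: nat] \<circ> transpose 2 6"
    and "u \<equiv> cycle_of_list [2, 3, 6, 4, 5 :: nat]" and "v \<equiv> cycle_of_list [1, 2, 5, 3, 4 :: nat]"
  shows "beauville_structure (alt_group 6) {(x, w), (u, v)}"
    and "strongly_real (alt_group 6) {(x, w), (u, v)}"
proof -
  let ?G = "alt_group 6"
  have six: "even (6 :: nat)" "(6 :: nat) > 5" by auto
  note xw = trot_pair42_carrier[OF six, folded x_def w_def] trot_pair42_generate[OF six, folded x_def w_def]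
    trot_pair42_fixpts[OF six, folded x_def w_def]
  note uv = cycle5_pair_carrier[folded u_def v_def] cycle5_pair_generate[folded u_def v_def]
    cycle5_pair_fixpts[folded u_def v_def]
  show "beauville_structure ?G {(x, w), (u, v)}"
  proof (rule beauville_structure_altI)
    fix p q k l
    assume p: "p \<in> {x, w, x \<circ> w}" and q: "q \<in> {u, v, u \<circ> v}" and eq: "fixpts 6 (p ^^ k) = fixpts 6 (q ^^ l)"
    have "even (fixpts 6 (p ^^ k))" using xw(4)[OF p] .
    moreover have "fixpts 6 (q ^^ l) = 1 \<or> fixpts 6 (q ^^ l) = 6" using uv(4)[OF q] by auto
    ultimately show "fixpts 6 (p ^^ k) = 6" using eq by auto
  qed (use xw uv in auto)
  have c: "syn_compat x (inv' x)" "syn_compat w (inv' w)" "syn_compat u (inv' u)" "syn_compat v (inv' v)"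
    using trot6_compat cycle42_compat cycle5_compat unfolding x_def w_def u_def v_def by blast+
  obtain \<phi> where phi: "\<phi> \<in> auto ?G" "\<And>g. g \<in> carrier ?G \<Longrightarrow> syn_compat g (inv' g) \<Longrightarrow> \<phi> g = inv' g"
    using syn_compat_auto[OF xw(1-3) c(1,2)] by blast
  have one: "\<one>\<^bsub>?G\<^esub> \<in> carrier ?G"
    using group.is_monoid[OF alt_group_is_group] by (rule monoid.one_closed)
  have "\<one>\<^bsub>?G\<^esub> \<otimes>\<^bsub>?G\<^esub> \<phi> g \<otimes>\<^bsub>?G\<^esub> inv\<^bsub>?G\<^esub> \<one>\<^bsub>?G\<^esub> = inv\<^bsub>?G\<^esub> g"
    if "g \<in> carrier ?G" "syn_compat g (inv' g)" for g
    using phi(2)[OF that] that(1) one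
    by (simp add: alt_group_mult alt_group_inv_equality alt_group_one)
  then show "strongly_real ?G {(x, w), (u, v)}"
    unfolding strongly_real_def using phi(1) one xw(1,2) uv(1,2) c by blast
qed

section \<open>Structures of both kinds\<close>

text \<open>Both inverting permutations have the parity of \<open>(n - 1) div 2\<close>.\<close>

lemma evenperm_inverters:
  assumes "n > 6" "a \<noteq> b"
  shows "evenperm (transpose a b \<circ> flip 4 n) \<longleftrightarrow> evenperm (transpose 1 2 \<circ> transpose 3 5 \<circ> flip 6 n)"
proof -
  have "permutation (flip c n)" for c
    using flip_permutes permutes_imp_permutation by blast
  moreover have "permutation (transpose 1 2 \<circ> transpose 3 (5 :: nat))"
    by (rule permutation_compose[OF permutation_swap_id permutation_swap_id])
  moreover have "evenperm (flip 6 n) \<longleftrightarrow> \<not> evenperm (flip 4 n)"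
    using evenperm_flip_shift[of 4 n] assms(1) by simp
  ultimately show ?thesis
    using assms(2) by (simp only: evenperm_comp permutation_swap_id evenperm_swap) simp
qed

lemma inverters_permute:
  assumes "n > 5"
  shows "a \<in> {1..3} \<Longrightarrow> b \<in> {1..3} \<Longrightarrow> transpose a b \<circ> flip 4 n permutes {1..n}"
    and "transpose 1 2 \<circ> transpose 3 5 \<circ> flip 6 n permutes {1..n}"
proof -
  have flip: "flip c n permutes {1..n}" if "1 \<le> c" for c
    by (rule permutes_subset[OF flip_permutes]) (use that in auto)
  have swap: "transpose i j permutes {1..n}" if "i \<in> {1..5}" "j \<in> {1..5}" for i j
    using that assms by (intro permutes_swap_id) auto
  show "transpose a b \<circ> flip 4 n permutes {1..n}" if "a \<in> {1..3}" "b \<in> {1..3}"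
    using that by (intro permutes_compose[OF flip swap]) auto
  have "transpose 1 2 \<circ> transpose 3 5 permutes {1..n}"
    by (intro permutes_compose[OF swap swap]) auto
  then show "transpose 1 2 \<circ> transpose 3 5 \<circ> flip 6 n permutes {1..n}"
    by (intro permutes_compose[OF flip]) auto
qed

text \<open>Switching the last point of the 3-cycle from 3 to 4 keeps generation and the fixed-point
  counts and destroys only the inverting reflection, so one statement yields both kinds.\<close>

lemma odd_structures:
  assumes n: "odd n" "n > 5" and d: "d \<in> {3, 4}"
  defines "B \<equiv> {(trot n, cycle_of_list [1, 2, 5, 4, 3]), (rot 1 n, cycle_of_list [1, 2, d])}"
  shows "beauville_structure (alt_group n) B"
    and "strongly_real (alt_group n) B \<longleftrightarrow> d = 3"
proof -
  have n6: "n > 6" using n by presburger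
  note P = trot_pair5_carrier[OF n6] trot_pair5_generate[OF n6]
  note Q = odd_cycle_pair_carrier[OF n d] odd_cycle_pair_generate[OF n d]
  note r = inverters_permute[OF n(2)]
  show "beauville_structure (alt_group n) B"
    unfolding B_def
  proof (rule beauville_structure_altI)
    fix p q k l
    assume p: "p \<in> {trot n, cycle_of_list [1, 2, 5, 4, 3], trot n \<circ> cycle_of_list [1, 2, 5, 4, 3]}"
      and q: "q \<in> {rot 1 n, cycle_of_list [1, 2, d], rot 1 n \<circ> cycle_of_list [1, 2, d]}"
      and eq: "fixpts n (p ^^ k) = fixpts n (q ^^ l)"
    \<comment> \<open>The lists 2, n - 5, n and 0, n - 3, n share only n, as n is at least
      7.\<close>
    show "fixpts n (p ^^ k) = n"
      using trot_pair5_fixpts[OF n6 p, of k] odd_cycle_pair_fixpts[OF n d q, of l] eq n6 n(1) by auto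
  qed (use P Q in auto)
  show "strongly_real (alt_group n) B \<longleftrightarrow> d = 3"
  proof (cases "d = 3")
    case True
    have "strongly_real (alt_group n) B"
      unfolding B_def True
      by (rule strongly_real_altI[OF P(1,2) Q(1) _ r(2) r(1) evenperm_inverters[OF n6, symmetric]
            trot_pair5_inverts[OF n6] odd_cycle_pair_inverts[OF n(2)]])
        (use Q(2) True in auto)
    then show ?thesis using True by simp
  next
    case False
    then have d4: "d = 4" using d by simp
    have "\<not> strongly_real (alt_group n) B"
      unfolding B_def d4
      by (rule not_strongly_real_altI[OF P(1,2) Q(1) _ P(3) r(2) trot_pair5_inverts[OF n6]
            odd_cycle_pair_not_inverted[OF n6]])
        (use Q(2) d4 in auto)
    then show ?thesis using False by simp
  qed
qed

lemma even_structure_strongly_real: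
  assumes n: "even n" "n > 6"
  defines "B \<equiv> {(trot n, cycle_of_list [1, 2, 5, 4, 3]), (rot 2 n, cycle_of_list [1, 3, 2])}"
  shows "beauville_structure (alt_group n) B" "strongly_real (alt_group n) B"
proof -
  have n5: "n > 5" using n by simp
  note P = trot_pair5_carrier[OF n(2)] trot_pair5_generate[OF n(2)]
  note Q = even_cycle_pair_carrier[OF n(1) n5] even_cycle_pair_generate[OF n(1) n5]
  note r = inverters_permute[OF n5]
  show "beauville_structure (alt_group n) B"
    unfolding B_def
  proof (rule beauville_structure_altI)
    fix p q k l
    assume p: "p \<in> {trot n, cycle_of_list [1, 2, 5, 4, 3], trot n \<circ> cycle_of_list [1, 2, 5, 4, 3]}"
      and q: "q \<in> {rot 2 n, cycle_of_list [1, 3, 2], rot 2 n \<circ> cycle_of_list [1, 3, 2]}"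
      and eq: "fixpts n (p ^^ k) = fixpts n (q ^^ l)"
    \<comment> \<open>For \<open>n = 6\<close> the two lists would meet in 1 = n - 5 and in 3 = n -
      3; from 8 on they share only n.\<close>
    have "n > 7" using n by presburger
    then show "fixpts n (p ^^ k) = n"
      using trot_pair5_fixpts[OF n(2) p, of k] even_cycle_pair_fixpts[OF n(1) n5 q, of l] eq n(1) by auto
  qed (use P Q in auto)
  show "strongly_real (alt_group n) B"
    unfolding B_def
    by (rule strongly_real_altI[OF P(1,2) Q(1,2) r(2) r(1) evenperm_inverters[OF n(2), symmetric]
          trot_pair5_inverts[OF n(2)] even_cycle_pair_inverts[OF n5]]) auto
qed

text \<open>Counts other than n are odd for the first pair and even for the second. The invertible
  pair stands first, since the criterion starts from a permutation inverting the first pair.\<close>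

lemma even_structure_not_strongly_real:
  assumes n: "even n" "n > 5"
  defines "B \<equiv> {(rot 2 n, cycle_of_list [1, 3, 2]), (trot n, cycle_of_list [1, 4, 5, 3] \<circ> transpose 2 6)}"
  shows "beauville_structure (alt_group n) B" "\<not> strongly_real (alt_group n) B"
proof -
  note P = trot_pair42_carrier[OF n] trot_pair42_generate[OF n]
  note Q = even_cycle_pair_carrier[OF n] even_cycle_pair_generate[OF n]
  show "beauville_structure (alt_group n) B"
    unfolding B_def
  proof (rule beauville_structure_altI)
    fix q p k l
    assume q: "q \<in> {rot 2 n, cycle_of_list [1, 3, 2], rot 2 n \<circ> cycle_of_list [1, 3, 2]}"
      and p: "p \<in> {trot n, cycle_of_list [1, 4, 5, 3] \<circ> transpose 2 6,
        trot n \<circ> (cycle_of_list [1, 4, 5, 3] \<circ> transpose 2 6)}"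
      and eq: "fixpts n (q ^^ k) = fixpts n (p ^^ l)"
    show "fixpts n (q ^^ k) = n"
      using trot_pair42_fixpts[OF n p, of l] even_cycle_pair_fixpts[OF n q, of k] eq n by auto
  qed (use P Q in auto)
  show "\<not> strongly_real (alt_group n) B"
    unfolding B_def
    by (rule not_strongly_real_altI[OF Q(1,2) P(1,2) Q(3) inverters_permute(1)[OF n(2)]
          even_cycle_pair_inverts[OF n(2)] trot_pair42_not_inverted[OF n]]) auto
qed

theorem lemma2p1:
  fixes n :: nat
  assumes "n > 5"
  shows "\<not> purely_strongly_real_beauville_group (alt_group n) \<and>
         \<not> purely_non_strongly_real_beauville_group (alt_group n)"
proof -
  have "\<exists>B. beauville_structure (alt_group n) B \<and> strongly_real (alt_group n) B"
  proof -
    consider "odd n" | "even n" "n > 6" | "n = 6" using assms by linarith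
    then show ?thesis
      using odd_structures[of n 3] even_structure_strongly_real[of n] strongly_real_alt6 assms
      by cases blast+
  qed
  moreover have "\<exists>B. beauville_structure (alt_group n) B \<and> \<not> strongly_real (alt_group n) B"
    using odd_structures[of n 4] even_structure_not_strongly_real[of n] assms by (cases "odd n") auto
  ultimately show ?thesis
    unfolding purely_strongly_real_beauville_group_def purely_non_strongly_real_beauville_group_def
    by blast
qed

end
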